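(* Let $K$ be an infinite field, let $d>1$, and let $C=C(3,d,K)$ be the nilpotency degree of $N_{3,d}$. Then: \begin{itemize} \item if $\operatorname{char}(K)=0$ or $\operatorname{char}(K)>3$, then $C=6$; \item if $\operatorname{char}(K)=2$, then $C=d+3$ for $d\ge 3$, and $C=6$ for $d=2$; \item if $\operatorname{char}(K)=3$, then $C=3d+1$ for $d$ even, and $C\in\{3d,\,3d+1\}$ for $d$ odd. \end{itemize}
   Context: $K\langle x_1,\dots,x_d\rangle$ is the free associative unital algebra over $K$, graded by degree, and $K\langle x_1,\dots,x_d\rangle^{\#}$ is its subspace of elements without constant term. $N_{n,d}=K\langle x_1,\dots,x_d\rangle/I$, where $I$ is the two-sided ideal generated by all $f^n$ with $f\in K\langle x_1,\dots,x_d\rangle^{\#}$. The nilpotency degree of a graded algebra $A=\bigoplus_{j\ge 0}A(j)$ with $A(0)=K$ is the least $C$ such that $a_1\cdots a_C=0$ for all $a_1,\dots,a_C\in A^{+}=\bigoplus_{j\ge 1}A(j)$. *)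

theory Defs
  imports
    "HOL-Library.Poly_Mapping"
    "HOL-Library.Extended_Nat"
    "HOL-Algebra.QuotRing"
    "HOL-Computational_Algebra.Computational_Algebra"
begin

text \<open>
  Words under concatenation, written additively so that the convolution product of
  \<open>HOL-Library.Poly_Mapping\<close> makes \<open>'a free_monoid \<Rightarrow>\<^sub>0 'k\<close> the monoid algebra of the free
  monoid, i.e. the free associative unital algebra on the letters \<open>'a\<close>.
\<close>

datatype 'a free_monoid = FM (letters: "'a list")

instantiation free_monoid :: (type) monoid_add
begin

definition zero_free_monoid :: "'a free_monoid" where
  "0 = FM []"

definition plus_free_monoid :: "'a free_monoid \<Rightarrow> 'a free_monoid \<Rightarrow> 'a free_monoid" where
  "u + v = FM (letters u @ letters v)"

instance
  by standard (simp_all add: zero_free_monoid_def plus_free_monoid_def)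

end

text \<open>The letters \<open>0, \<dots>, d - 1\<close> stand for \<open>x\<^sub>1, \<dots>, x\<^sub>d\<close>.\<close>

definition free_algebra :: "nat \<Rightarrow> (nat free_monoid \<Rightarrow>\<^sub>0 'k::field) ring" where
  "free_algebra d =
     \<lparr>carrier = {f. \<forall>w\<in>Poly_Mapping.keys f. set (letters w) \<subseteq> {..<d}},
      monoid.mult = (*), one = 1, zero = 0, add = (+)\<rparr>"

definition free_component :: "nat \<Rightarrow> nat \<Rightarrow> (nat free_monoid \<Rightarrow>\<^sub>0 'k::field) set" where
  "free_component d j =
     {f \<in> carrier (free_algebra d). \<forall>w\<in>Poly_Mapping.keys f. length (letters w) = j}"

definition free_algebra_sharp :: "nat \<Rightarrow> (nat free_monoid \<Rightarrow>\<^sub>0 'k::field) set" where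
  "free_algebra_sharp d = {f \<in> carrier (free_algebra d). Poly_Mapping.lookup f 0 = 0}"

text \<open>
  \<^const>\<open>genideal\<close> yields two-sided ideals; since the ring contains the scalars, they are
  closed under scalar multiplication.
\<close>

definition nil_ideal :: "nat \<Rightarrow> nat \<Rightarrow> (nat free_monoid \<Rightarrow>\<^sub>0 'k::field) set" where
  "nil_ideal n d =
     genideal (free_algebra d) {f [^]\<^bsub>free_algebra d\<^esub> n |f. f \<in> free_algebra_sharp d}"

definition nil_algebra :: "nat \<Rightarrow> nat \<Rightarrow> (nat free_monoid \<Rightarrow>\<^sub>0 'k::field) set ring" where
  "nil_algebra n d = free_algebra d Quot nil_ideal n d"

definition nil_component :: "nat \<Rightarrow> nat \<Rightarrow> nat \<Rightarrow> (nat free_monoid \<Rightarrow>\<^sub>0 'k::field) set set" where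
  "nil_component n d j = (\<lambda>f. nil_ideal n d +>\<^bsub>free_algebra d\<^esub> f) ` free_component d j"

text \<open>The subspace \<open>A\<^sup>+\<close> of a ring \<open>A\<close> with graded components \<open>G 0, G 1, \<dots>\<close>.\<close>

definition positive_part :: "('a, 'b) ring_scheme \<Rightarrow> (nat \<Rightarrow> 'a set) \<Rightarrow> 'a set" where
  "positive_part A G = {finsum A a {1..m} |a m. \<forall>j\<in>{1..m}. a j \<in> G j}"

text \<open>The least \<open>C\<close> such that all products of \<open>C\<close> elements of \<open>A\<^sup>+\<close> vanish; \<open>\<infinity>\<close> if there is none.\<close>

definition nilpotency_degree :: "('a, 'b) ring_scheme \<Rightarrow> (nat \<Rightarrow> 'a set) \<Rightarrow> enat" where
  "nilpotency_degree A G =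
     Inf {enat C |C. \<forall>as. length as = C \<and> set as \<subseteq> positive_part A G \<longrightarrow>
       foldr (\<otimes>\<^bsub>A\<^esub>) as \<one>\<^bsub>A\<^esub> = \<zero>\<^bsub>A\<^esub>}"

definition nil_algebra_degree :: "nat \<Rightarrow> nat \<Rightarrow> 'k::field itself \<Rightarrow> enat" where
  "nil_algebra_degree n d K =
     nilpotency_degree (nil_algebra n d :: (nat free_monoid \<Rightarrow>\<^sub>0 'k) set ring) (nil_component n d)"

lemma ring_free_algebra: "ring (free_algebra d :: (nat free_monoid \<Rightarrow>\<^sub>0 'k::field) ring)"
proof (intro ringI abelian_groupI monoidI)
  let ?R = "free_algebra d :: (nat free_monoid \<Rightarrow>\<^sub>0 'k) ring"
  show "x \<oplus>\<^bsub>?R\<^esub> y \<in> carrier ?R" if "x \<in> carrier ?R" "y \<in> carrier ?R" for x y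
    using that Poly_Mapping.keys_add[of x y] by (fastforce simp: free_algebra_def)
  show "x \<otimes>\<^bsub>?R\<^esub> y \<in> carrier ?R" if "x \<in> carrier ?R" "y \<in> carrier ?R" for x y
    using that keys_mult[of x y] by (fastforce simp: free_algebra_def plus_free_monoid_def)
  show "\<exists>y\<in>carrier ?R. y \<oplus>\<^bsub>?R\<^esub> x = \<zero>\<^bsub>?R\<^esub>" if "x \<in> carrier ?R" for x
    using that by (intro bexI[of _ "- x"]) (auto simp: free_algebra_def)
qed (auto simp: free_algebra_def zero_free_monoid_def algebra_simps)

lemma ideal_nil_ideal: "ideal (nil_ideal n d) (free_algebra d)"
proof -
  interpret ring "free_algebra d" by (rule ring_free_algebra)
  show ?thesis
    unfolding nil_ideal_def
    by (rule genideal_ideal) (auto simp: free_algebra_sharp_def)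
qed

lemma ring_nil_algebra: "ring (nil_algebra n d)"
  unfolding nil_algebra_def by (rule ideal.quotient_is_ring[OF ideal_nil_ideal])

end

theory Submission
  imports Defs
begin

text \<open>
  Since \<open>K\<close> is infinite, the ideal contains, besides the cubes, the linearizations
  \<open>aab + aba + baa\<close> and \<open>\<Sum> abc\<close> (over all six orders) for \<open>a, b, c\<close> without constant term. Because
  products of \<open>C\<close> elements of \<open>A\<^sup>+\<close> are combinations of words of length at least \<open>C\<close>, the degree is
  one more than the length of the longest word that is nonzero in \<open>N\<^sub>3\<^sub>,\<^sub>d\<close>. Upper bounds are rewriting
  arguments on words, lower bounds are linear functionals on words that vanish on the ideal.

  Upper bounds. From \<open>aba = - aab - baa\<close> one gets \<open>aaba = - abaa\<close> and \<open>aabaa = 0\<close>; hence a word with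
  four occurrences of one letter is zero, which gives \<open>3 d + 1\<close> in every characteristic
  (\<open>null_if_length_gt\<close>). If \<open>3\<close> is invertible, Higman's computation yields \<open>xxzyy = 0\<close>. Then words with
  three \<open>x\<close>, two \<open>y\<close> and at least one more letter vanish, as do words with three repeated letters, so
  that length \<open>max 6 (d + 3)\<close> suffices (\<open>null_if_length_ge\<close>). If \<open>2\<close> is invertible as well, polarizing
  \<open>xxzyy = 0\<close> shows that a product of six factors changes sign when two neighbours are swapped, and the
  identity \<open>\<Sum> abc = 0\<close> for three factors of degree two then reads \<open>6 a\<^sub>1 \<cdots> a\<^sub>6 = 0\<close> (\<open>product_of_six\<close>).

  Lower bounds. There is a functional in degree five, with integer values, that is \<open>1\<close> on \<open>xxyyx\<close> (\<open>sign_form\<close>).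
  In characteristic two, count the factors \<open>xx\<close> of words with three \<open>x\<close> in which all other letters are distinct
  (\<open>pair_form\<close>). In characteristic three, put \<open>x\<^sub>i = t\<^sub>i + e\<^sub>i\<close> in the algebra
  \<open>K[t\<^sub>1, \<dots>, t\<^sub>d]/(t\<^sub>i\<^sup>3) \<otimes> \<Lambda>(e\<^sub>1, \<dots>, e\<^sub>d)\<close>: commutators are central there, which implies both
  linearized identities, and the cube of an element without constant term is the cube of its even part, hence
  zero. For even \<open>d\<close> the top monomial \<open>t\<^sub>1\<^sup>2 \<cdots> t\<^sub>d\<^sup>2 e\<^sub>1 \<cdots> e\<^sub>d\<close> occurs in the value of a word of length
  \<open>3 d\<close>; for odd \<open>d\<close> the same holds for this monomial without \<open>e\<^sub>d\<close> and length \<open>3 d - 1\<close>.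
\<close>

section \<open>Rewriting words modulo the linearized cube identity\<close>

text \<open>
  The predicate stands for membership of a word in the ideal. The last three assumptions are the identity
  \<open>xxv + xvx + vxx = 0\<close>, of which only this remains when signs are forgotten: if two of the three words
  vanish, so does the third.
\<close>

locale null_words =
  fixes null :: "'a list \<Rightarrow> bool"
  assumes extend: "null w \<Longrightarrow> null (u @ w @ v)"
    and cube: "null [x, x, x]"
    and join: "null (u @ [x, x] @ v @ t) \<Longrightarrow> null (u @ v @ [x, x] @ t) \<Longrightarrow> null (u @ [x] @ v @ [x] @ t)"
    and move_left: "v \<noteq> [] \<Longrightarrow> null (u @ [x] @ v @ [x] @ t) \<Longrightarrow> null (u @ v @ [x, x] @ t) \<Longrightarrow> null (u @ [x, x] @ v @ t)"
    and move_right: "v \<noteq> [] \<Longrightarrow> null (u @ [x] @ v @ [x] @ t) \<Longrightarrow> null (u @ [x, x] @ v @ t) \<Longrightarrow> null (u @ v @ [x, x] @ t)"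
begin

lemma null_factor: "null w \<Longrightarrow> w' = u @ w @ v \<Longrightarrow> null w'"
  using extend by blast

text \<open>
  Multiplying \<open>xxv + xvx + vxx = 0\<close> by \<open>x\<close> kills one of the three words because of the factor \<open>xxx\<close>.
\<close>

lemma shift_square:
  assumes "v \<noteq> []"
  shows "null (u @ [x, x] @ v @ [x] @ t) \<longleftrightarrow> null (u @ [x] @ v @ [x, x] @ t)"
proof
  assume "null (u @ [x, x] @ v @ [x] @ t)"
  then show "null (u @ [x] @ v @ [x, x] @ t)"
    using move_right[of v "u @ [x]" x t] null_factor[OF cube[of x], of "(u @ [x]) @ [x, x] @ v @ t" u "v @ t"] assms
    by simp
next
  assume "null (u @ [x] @ v @ [x, x] @ t)"
  then show "null (u @ [x, x] @ v @ [x] @ t)"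
    using move_left[of v u x "[x] @ t"] null_factor[OF cube[of x], of "u @ v @ [x, x] @ [x] @ t" "u @ v" t] assms
    by simp
qed

lemma two_equal_squares: "null (u @ [x, x] @ v @ [x, x] @ t)"
proof (cases "v = []")
  case True
  then show ?thesis using null_factor[OF cube[of x], of _ u "[x] @ t"] by simp
next
  case False
  then show ?thesis
    using shift_square[of v u x "[x] @ t"] null_factor[OF cube[of x], of "u @ [x] @ v @ [x, x] @ [x] @ t" "u @ [x] @ v" t]
    by simp
qed

lemma square_and_two_letters: "null (u @ [x, x] @ v @ [x] @ s @ [x] @ t)"
  using join[of "u @ [x, x] @ v" x s t] two_equal_squares[of u x v "s @ t"] two_equal_squares[of u x "v @ s" t]
  by simp

text \<open>
  Gathering the first two of four occurrences of \<open>x\<close> leaves a square followed by two more \<open>x\<close>; gathering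
  these two gives \<open>xx \<dots> xx\<close>.
\<close>

lemma null_if_count_ge_4:
  assumes "count_list w x \<ge> 4"
  shows "null w"
proof -
  have split: "\<exists>p q. l = p @ [x] @ q \<and> count_list q x \<ge> n" if "count_list l x \<ge> Suc n" for l n
  proof -
    from that have "x \<in> set l" by (metis count_list_0_iff not_less_eq_eq zero_le)
    then obtain p q where "l = p @ x # q" "x \<notin> set p" by (metis split_list_first)
    then show ?thesis using that by (intro exI[of _ p] exI[of _ q]) auto
  qed
  obtain a w1 where 1: "w = a @ [x] @ w1" "count_list w1 x \<ge> 3" using split[of 3 w] assms by auto
  obtain b w2 where 2: "w1 = b @ [x] @ w2" "count_list w2 x \<ge> 2" using split[of 2 w1] 1 by auto
  obtain c w3 where 3: "w2 = c @ [x] @ w3" "count_list w3 x \<ge> 1" using split[of 1 w2] 2 by auto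
  obtain e f where 4: "w3 = e @ [x] @ f" using split[of 0 w3] 3 by auto
  have "w = a @ [x] @ b @ [x] @ c @ [x] @ e @ [x] @ f" using 1 2 3 4 by simp
  then show ?thesis
    using join[of a x b "c @ [x] @ e @ [x] @ f"] square_and_two_letters[of a x "b @ c" e f]
      square_and_two_letters[of "a @ b" x c e f]
    by simp
qed

lemma null_if_length_gt:
  assumes "finite D" "set w \<subseteq> D" "length w > 3 * card D"
  shows "null w"
proof (rule ccontr)
  assume "\<not> null w"
  then have *: "count_list w x \<le> 3" for x
    using null_if_count_ge_4[of w x] by linarith
  have "length w = (\<Sum>x\<in>set w. count_list w x)"
    by (simp add: sum_count_set)
  also have "\<dots> \<le> (\<Sum>x\<in>set w. 3)" by (rule sum_mono) (rule *)
  also have "\<dots> \<le> 3 * card D" using card_mono[OF assms(1,2)] by simp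
  finally show False using assms(3) by simp
qed

end

definition has_square :: "'a \<Rightarrow> 'a list \<Rightarrow> bool" where
  "has_square x w \<longleftrightarrow> (\<exists>u v. w = u @ [x, x] @ v)"

lemma has_square_append: "has_square x u \<or> has_square x v \<Longrightarrow> has_square x (u @ v)"
  unfolding has_square_def by (metis append.assoc)

lemma has_square_separated:
  assumes "y \<noteq> x" "has_square y (p @ [x] @ q)"
  shows "has_square y p \<or> has_square y q"
proof -
  obtain u v where "p @ [x] @ q = u @ [y, y] @ v" using assms(2) by (auto simp: has_square_def)
  then show ?thesis
    using assms(1)
    unfolding has_square_def by (auto simp: append_eq_append_conv2 append_eq_Cons_conv Cons_eq_append_conv)
qed

lemma two_squares_cases:
  assumes "x \<noteq> y" "has_square x w" "has_square y w"
  obtains u v t where "w = u @ [x, x] @ v @ [y, y] @ t" | u v t where "w = u @ [y, y] @ v @ [x, x] @ t"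
proof -
  obtain u v where w: "w = u @ [x, x] @ v" using assms(2) by (auto simp: has_square_def)
  then have "has_square y u \<or> has_square y v"
    using assms(1,3) has_square_separated[of y x u "[x] @ v"] has_square_separated[of y x "[]" v]
    by (auto simp: has_square_def)
  then show ?thesis
    using that w unfolding has_square_def by fastforce
qed

context null_words
begin

text \<open>
  It suffices to treat the words in which two occurrences of \<open>x\<close> have been brought together. The squares of other
  letters survive this step, as they lie between the occurrences of \<open>x\<close>, so the lemma can be
  applied to several letters in turn.
\<close>

lemma gather_square:
  assumes "count_list w x \<ge> 2"
    and "\<And>w'. mset w' = mset w \<Longrightarrow> has_square x w' \<Longrightarrow>
      (\<And>y. y \<noteq> x \<Longrightarrow> has_square y w \<Longrightarrow> has_square y w') \<Longrightarrow> null w'"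
  shows "null w"
proof -
  have "x \<in> set w" using assms(1) by (metis count_list_0_iff not_numeral_le_zero)
  then obtain p r where w: "w = p @ x # r" "x \<notin> set p" by (metis split_list_first)
  then have "x \<in> set r" using assms(1) by (intro ccontr[of "x \<in> set r"]) simp
  then obtain b q where r: "r = b @ x # q" by (metis split_list)
  have eq: "w = p @ [x] @ b @ [x] @ q" using w r by simp
  have sq: "has_square y p \<or> has_square y b \<or> has_square y q" if "y \<noteq> x" "has_square y w" for y
    using has_square_separated[of y x p "b @ [x] @ q"] has_square_separated[of y x b q] that eq by auto
  have "null (p @ [x, x] @ b @ q)"
  proof (rule assms(2))
    show "has_square y (p @ [x, x] @ b @ q)" if "y \<noteq> x" "has_square y w" for y
      using sq[OF that] has_square_append[of y p "[x, x] @ b @ q"] has_square_append[of y "[x, x]" "b @ q"]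
        has_square_append[of y b q] by blast
  qed (auto simp: eq has_square_def)
  moreover have "null (p @ b @ [x, x] @ q)"
  proof (rule assms(2))
    show "has_square x (p @ b @ [x, x] @ q)"
      unfolding has_square_def by (intro exI[of _ "p @ b"] exI[of _ q]) simp
    show "has_square y (p @ b @ [x, x] @ q)" if "y \<noteq> x" "has_square y w" for y
      using sq[OF that] has_square_append[of y p "b @ [x, x] @ q"] has_square_append[of y b "[x, x] @ q"]
        has_square_append[of y "[x, x]" q] by blast
  qed (auto simp: eq)
  ultimately show ?thesis unfolding eq by (rule join)
qed

end

text \<open>
  The extra rule is \<open>xxzyy = 0\<close>, the form in which the invertibility of \<open>3\<close> enters the
  arguments on words.
\<close>

locale null_words_separated = null_words +
  assumes separated_squares: "z \<noteq> [] \<Longrightarrow> null ([x, x] @ z @ [y, y])"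
begin

lemma separated_squares_factor: "z \<noteq> [] \<Longrightarrow> null (u @ [x, x] @ z @ [y, y] @ t)"
  using null_factor[OF separated_squares[of z x y], of _ u t] by simp

text \<open>
  Of three squares, two are separated by the third or by another letter.
\<close>

lemma three_squares:
  assumes "x \<noteq> y" "x \<noteq> z" "y \<noteq> z" "has_square x w" "has_square y w" "has_square z w"
  shows "null w"
proof -
  have *: "null w" if "w = u @ [a, a] @ v @ [b, b] @ t" "has_square c w" "a \<noteq> c" "b \<noteq> c" for a b c u v t
  proof (cases "v = []")
    case False
    then show ?thesis using that separated_squares_factor by simp
  next
    case True
    have "has_square c u \<or> has_square c t"
      using has_square_separated[of c a u "[a] @ [b, b] @ t"] has_square_separated[of c a "[]" "[b, b] @ t"]
        has_square_separated[of c b "[]" "[b] @ t"] has_square_separated[of c b "[]" "t"] that True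
      by (auto simp: has_square_def[of _ "[]"])
    then show ?thesis
    proof
      assume "has_square c u"
      then obtain k l where "u = k @ [c, c] @ l" by (auto simp: has_square_def)
      then show ?thesis using that True separated_squares_factor[of "l @ [a, a]" k c b t] by simp
    next
      assume "has_square c t"
      then obtain k l where "t = k @ [c, c] @ l" by (auto simp: has_square_def)
      then show ?thesis using that True separated_squares_factor[of "[b, b] @ k" u a c l] by simp
    qed
  qed
  show ?thesis using two_squares_cases[OF assms(1,4,5)] * assms by metis
qed

text \<open>
  The word \<open>xxyyx\<close> itself is nonzero in general, but no letter can be added to it, on either side.
\<close>

lemma null_left_extension: "null ([a] @ [x, x] @ [y, y] @ [x])"
proof -
  have "null ([x, x] @ [a] @ [y, y] @ [x])"
    using separated_squares_factor[of "[a]" "[]" x y "[x]"] by simp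
  moreover have "null ([x] @ [a] @ [x] @ [y, y] @ [x])"
  proof -
    have "null ([x] @ [a] @ [x, x] @ [y, y])"
      using shift_square[of "[a]" "[]" x "[y, y]"] separated_squares_factor[of "[a, x]" "[]" x y "[]"] by simp
    moreover have "null ([x] @ [a] @ [y, y] @ [x, x])"
      using shift_square[of "[a, y, y]" "[]" x "[]"] separated_squares_factor[of "[a]" "[]" x y "[x]"] by simp
    ultimately show ?thesis using join[of "[x, a]" x "[y, y]" "[]"] by simp
  qed
  ultimately show ?thesis using move_right[of "[a]" "[]" x "[y, y, x]"] by simp
qed

lemma null_right_extension: "null ([x, x] @ [y, y] @ [x] @ [a])"
proof -
  have "null ([x] @ [y, y] @ [a] @ [x, x])"
    using separated_squares_factor[of "[a]" "[x]" y x "[]"] by simp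
  moreover have "null ([x] @ [y, y] @ [x] @ [a] @ [x])"
  proof -
    have "null ([x, x] @ [y, y] @ [a] @ [x])"
      using shift_square[of "[y, y, a]" "[]" x "[]"] separated_squares_factor[of "[a]" "[x]" y x "[]"] by simp
    moreover have "null ([y, y] @ [x, x] @ [a] @ [x])"
      using shift_square[of "[a]" "[y, y]" x "[]"] separated_squares_factor[of "[x, a]" "[]" y x "[]"] by simp
    ultimately show ?thesis using join[of "[]" x "[y, y]" "[a, x]"] by simp
  qed
  ultimately have "null ([x] @ [y, y] @ [x, x] @ [a])"
    using move_left[of "[a]" "[x, y, y]" x "[]"] by simp
  then show ?thesis using shift_square[of "[y, y]" "[]" x "[a]"] by simp
qed

lemma null_extension:
  assumes "u \<noteq> [] \<or> t \<noteq> []"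
  shows "null (u @ [x, x] @ [y, y] @ [x] @ t)"
proof (cases "u = []")
  case True
  then obtain a s where "t = a # s" using assms by (cases t) auto
  then show ?thesis using null_factor[OF null_right_extension[of x y a], of _ u s] by simp
next
  case False
  then obtain a s where "u = s @ [a]" by (cases u rule: rev_cases) auto
  then show ?thesis using null_factor[OF null_left_extension[of a x y], of _ s t] by simp
qed

text \<open>
  After gathering \<open>xx\<close> and \<open>yy\<close> only the case of adjacent squares is left. Shifting \<open>xx\<close> towards the third
  \<open>x\<close> separates them, unless the word is \<open>xxyyx\<close> or \<open>xyyxx\<close> inside a longer word.
\<close>

lemma null_if_cube_and_square_degree:
  assumes "x \<noteq> y" "count_list w x \<ge> 3" "count_list w y \<ge> 2" "length w \<ge> 6"
  shows "null w"
proof (rule gather_square[of w x], use assms in simp)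
  fix w' assume w': "mset w' = mset w" "has_square x w'"
  show "null w'"
  proof (rule gather_square[of w' y])
    show "count_list w' y \<ge> 2"
      using assms w' by (metis count_mset)
    fix w'' assume w'': "mset w'' = mset w'" "has_square y w''" "\<And>z. z \<noteq> y \<Longrightarrow> has_square z w' \<Longrightarrow> has_square z w''"
    have sq: "has_square x w''" using w'' w' assms by blast
    have cnt: "count_list w'' x \<ge> 3" using assms w' w'' by (metis count_mset)
    have len: "length w'' \<ge> 6" using assms w' w'' by (metis size_mset)
    from assms(1) sq w''(2) show "null w''"
    proof (cases rule: two_squares_cases)
      case (1 u v t)
      show ?thesis
      proof (cases "v = []")
        case False
        then show ?thesis using 1 separated_squares_factor by simp
      next
        case True
        have "x \<in> set u \<or> x \<in> set t"
          using cnt 1 True assms(1) by (intro ccontr[of "x \<in> set u \<or> x \<in> set t"]) simp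
        then show ?thesis
        proof
          assume "x \<in> set u"
          then obtain p q where u: "u = p @ x # q" by (metis split_list)
          show ?thesis
          proof (cases "q = []")
            case True
            then show ?thesis using null_factor[OF cube[of x], of _ p "v @ [y, y] @ t"] u 1 by simp
          next
            case False
            then show ?thesis
              using shift_square[of q p x "[y, y] @ t"] separated_squares_factor[of "q @ [x]" p x y t] u 1 True by simp
          qed
        next
          assume "x \<in> set t"
          then obtain p q where t: "t = p @ x # q" by (metis split_list)
          show ?thesis
          proof (cases "p = []")
            case True
            then show ?thesis using null_extension[of u q x y] len t 1 \<open>v = []\<close> by (cases u; cases q) simp_all
          next
            case False
            then show ?thesis
              using shift_square[of "[y, y] @ p" u x q] separated_squares_factor[of p "u @ [x]" y x q] t 1 True by simp
          qed
        qed
      qed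
    next
      case (2 u v t)
      show ?thesis
      proof (cases "v = []")
        case False
        then show ?thesis using 2 separated_squares_factor by simp
      next
        case True
        have "x \<in> set u \<or> x \<in> set t"
          using cnt 2 True assms(1) by (intro ccontr[of "x \<in> set u \<or> x \<in> set t"]) simp
        then show ?thesis
        proof
          assume "x \<in> set t"
          then obtain p q where t: "t = p @ x # q" by (metis split_list)
          show ?thesis
          proof (cases "p = []")
            case True
            then show ?thesis using null_factor[OF cube[of x], of _ "u @ [y, y]" q] t 2 \<open>v = []\<close> by simp
          next
            case False
            then show ?thesis
              using shift_square[of p "u @ [y, y]" x q] separated_squares_factor[of "[x] @ p" u y x q] t 2 True by simp
          qed
        next
          assume "x \<in> set u"
          then obtain p q where u: "u = p @ x # q" by (metis split_list)
          show ?thesis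
          proof (cases "q = []")
            case True
            then show ?thesis
              using null_extension[of p t x y] shift_square[of "[y, y]" p x t] len u 2 \<open>v = []\<close>
              by (cases p; cases t) simp_all
          next
            case False
            then show ?thesis
              using shift_square[of "q @ [y, y]" p x t] separated_squares_factor[of q p x y "[x] @ t"] u 2 True by simp
          qed
        qed
      qed
    qed
  qed
qed

lemma null_if_three_square_degrees:
  assumes "x \<noteq> y" "x \<noteq> z" "y \<noteq> z" "count_list w x \<ge> 2" "count_list w y \<ge> 2" "count_list w z \<ge> 2"
  shows "null w"
proof (rule gather_square[OF assms(4)])
  fix w1 assume 1: "mset w1 = mset w" "has_square x w1"
  show "null w1"
  proof (rule gather_square[of w1 y])
    show "count_list w1 y \<ge> 2" using assms 1 by (metis count_mset)
    fix w2 assume 2: "mset w2 = mset w1" "has_square y w2" "\<And>y'. y' \<noteq> y \<Longrightarrow> has_square y' w1 \<Longrightarrow> has_square y' w2"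
    show "null w2"
    proof (rule gather_square[of w2 z])
      show "count_list w2 z \<ge> 2" using assms 1 2 by (metis count_mset)
    qed (use 1 2 assms three_squares[of x y z] in blast)
  qed
qed

text \<open>
  The repetitions of letters have total excess at least three, and each letter has excess at most
  two, as words with four equal letters vanish. So either three letters are repeated, or one letter occurs three times and another one twice.
\<close>

lemma null_if_length_ge:
  assumes "finite D" "set w \<subseteq> D" "length w \<ge> card D + 3" "length w \<ge> 6"
  shows "null w"
proof (rule ccontr)
  assume nn: "\<not> null w"
  define A where "A = {x \<in> set w. count_list w x \<ge> 2}"
  have fin: "finite A" and sub: "A \<subseteq> set w" by (auto simp: A_def)
  have le3: "count_list w x \<le> 3" for x
    using null_if_count_ge_4[of w x] nn by linarith
  have le2: "count_list w x \<le> 2" if "y \<in> A" "x \<noteq> y" for x y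
    using null_if_cube_and_square_degree[of x y w] that nn assms(4) by (force simp: A_def)
  have "length w = (\<Sum>x\<in>set w. count_list w x)"
    by (simp add: sum_count_set)
  also have "\<dots> = (\<Sum>x\<in>set w. 1 + (count_list w x - 1))"
  proof (rule sum.cong)
    show "count_list w x = 1 + (count_list w x - 1)" if "x \<in> set w" for x
      using that count_list_0_iff[of w x] by linarith
  qed simp
  also have "\<dots> = card (set w) + (\<Sum>x\<in>set w. count_list w x - 1)"
    by (subst sum.distrib) simp
  also have "(\<Sum>x\<in>set w. count_list w x - 1) = (\<Sum>x\<in>A. count_list w x - 1)"
    by (rule sum.mono_neutral_right) (auto simp: A_def)
  finally have "(\<Sum>x\<in>A. count_list w x - 1) \<ge> 3"
    using assms(3) card_mono[OF assms(1,2)] by linarith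
  moreover have "(\<Sum>x\<in>A. count_list w x - 1) \<le> 2"
  proof -
    have "card A \<le> 2"
    proof (rule ccontr)
      assume "\<not> card A \<le> 2"
      then obtain B where "B \<subseteq> A" "card B = 3" by (metis obtain_subset_with_card_n not_less_eq_eq numeral_3_eq_3 numeral_2_eq_2)
      then obtain x y z where "B = {x, y, z}" "x \<noteq> y" "x \<noteq> z" "y \<noteq> z" by (metis card_3_iff)
      then show False using null_if_three_square_degrees[of x y z w] nn \<open>B \<subseteq> A\<close> by (auto simp: A_def)
    qed
    then consider "card A = 0" | "card A = 1" | "card A = 2" by linarith
    then show ?thesis
    proof cases
      case 1
      then show ?thesis using fin by simp
    next
      case 2
      then obtain x where "A = {x}" by (metis card_1_singletonE)
      then show ?thesis using le3[of x] by simp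
    next
      case 3
      then obtain x y where "A = {x, y}" "x \<noteq> y" by (metis card_2_iff)
      then show ?thesis using le2[of x y] le2[of y x] by simp
    qed
  qed
  ultimately show False by simp
qed

end

section \<open>Ideals that satisfy the linearized cube identity\<close>

locale nil_cube_ideal =
  fixes S I :: "'r::ring_1 set"
  assumes S_add: "a \<in> S \<Longrightarrow> b \<in> S \<Longrightarrow> a + b \<in> S"
    and S_mult: "a \<in> S \<Longrightarrow> b \<in> S \<Longrightarrow> a * b \<in> S"
    and I_add: "a \<in> I \<Longrightarrow> b \<in> I \<Longrightarrow> a + b \<in> I"
    and I_minus: "a \<in> I \<Longrightarrow> - a \<in> I"
    and I_left: "r \<in> S \<Longrightarrow> a \<in> I \<Longrightarrow> r * a \<in> I"
    and I_right: "a \<in> I \<Longrightarrow> r \<in> S \<Longrightarrow> a * r \<in> I"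
    and cube_linear: "a \<in> S \<Longrightarrow> b \<in> S \<Longrightarrow> a * a * b + a * b * a + b * a * a \<in> I"
begin

lemma I_diff: "a \<in> I \<Longrightarrow> b \<in> I \<Longrightarrow> a - b \<in> I"
  using I_add[of a "- b"] I_minus[of b] by simp

lemma cube_multilinear:
  assumes "a \<in> S" "b \<in> S" "c \<in> S"
  shows "a * b * c + a * c * b + b * a * c + b * c * a + c * a * b + c * b * a \<in> I"
proof -
  let ?T = "\<lambda>a b. a * a * b + a * b * a + b * a * a"
  have "?T (a + b) c - ?T a c - ?T b c \<in> I"
    by (intro I_diff cube_linear S_add assms)
  also have "?T (a + b) c - ?T a c - ?T b c =
      a * b * c + a * c * b + b * a * c + b * c * a + c * a * b + c * b * a"
    by (simp add: algebra_simps)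
  finally show ?thesis .
qed

text \<open>
  Higman's argument: in the double sum of \<open>x\<^sup>i z y\<^sup>j x\<^sup>2\<^sup>-\<^sup>i y\<^sup>2\<^sup>-\<^sup>j\<close> over \<open>0 \<le> i, j \<le> 2\<close>, the sum over \<open>i\<close>
  vanishes for each \<open>j\<close>. For \<open>i < 2\<close> the sum over \<open>j\<close> vanishes, and for \<open>i = 2\<close> all three terms are \<open>xxzyy\<close>.
\<close>

lemma triple_separated_squares:
  assumes "x \<in> S" "y \<in> S" "z \<in> S"
  shows "x * x * z * y * y + x * x * z * y * y + x * x * z * y * y \<in> I"
proof -
  let ?T = "\<lambda>a b. a * a * b + a * b * a + b * a * a"
  have "?T x z * (y * y) + ?T x (z * y) * y + ?T x (z * y * y) - x * z * ?T y x - z * ?T y (x * x) \<in> I"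
    using assms by (intro I_diff I_add I_right[OF cube_linear] I_left[OF _ cube_linear] cube_linear S_mult)
  also have "?T x z * (y * y) + ?T x (z * y) * y + ?T x (z * y * y) - x * z * ?T y x - z * ?T y (x * x) =
      x * x * z * y * y + x * x * z * y * y + x * x * z * y * y"
    by (simp add: algebra_simps)
  finally show ?thesis .
qed

end

locale nil_cube_ideal_6 = nil_cube_ideal +
  assumes two: "a + a \<in> I \<Longrightarrow> a \<in> I"
    and three: "a + a + a \<in> I \<Longrightarrow> a \<in> I"
begin

lemma separated_anticommutators:
  assumes "x \<in> S" "x' \<in> S" "z \<in> S" "y \<in> S" "y' \<in> S"
  shows "(x * x' + x' * x) * z * (y * y' + y' * y) \<in> I"
proof -
  have sep: "x * x * z * y * y \<in> I" if "x \<in> S" "y \<in> S" for x y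
    using three triple_separated_squares that assms by blast
  have lin: "(x * x' + x' * x) * z * y * y \<in> I" if "y \<in> S" for y
  proof -
    have "(x + x') * (x + x') * z * y * y - x * x * z * y * y - x' * x' * z * y * y \<in> I"
      by (intro I_diff sep S_add assms that)
    also have "(x + x') * (x + x') * z * y * y - x * x * z * y * y - x' * x' * z * y * y =
        (x * x' + x' * x) * z * y * y"
      by (simp add: algebra_simps)
    finally show ?thesis .
  qed
  let ?p = "(x * x' + x' * x) * z"
  have "?p * (y + y') * (y + y') - ?p * y * y - ?p * y' * y' \<in> I"
    by (intro I_diff lin S_add assms)
  also have "?p * (y + y') * (y + y') - ?p * y * y - ?p * y' * y' = ?p * (y * y' + y' * y)"
    by (simp add: distrib_left distrib_right mult.assoc)
  finally show ?thesis .
qed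

text \<open>
  Expand \<open>(x \<circ> a) b (x \<circ> c) = 0\<close>, where \<open>\<circ>\<close> is the anticommutator, and bring the two \<open>x\<close> together
  by \<open>xvx = - xxv - vxx\<close>: every position of the square is hit twice.
\<close>

lemma square_positions_three:
  assumes "x \<in> S" "a \<in> S" "b \<in> S" "c \<in> S"
  shows "x * x * a * b * c + a * x * x * b * c + a * b * x * x * c + a * b * c * x * x \<in> I" (is "?e \<in> I")
proof (rule two)
  let ?T = "\<lambda>a b. a * a * b + a * b * a + b * a * a"
  have "?T x (a * b) * c + ?T x (a * b * c) + a * (?T x b * c) + a * ?T x (b * c)
      - (x * a + a * x) * b * (x * c + c * x) \<in> I"
    using assms
    by (intro I_diff I_add I_right[OF cube_linear] I_left[OF _ I_right[OF cube_linear]]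
        I_left[OF _ cube_linear] cube_linear separated_anticommutators S_mult)
  also have "?T x (a * b) * c + ?T x (a * b * c) + a * (?T x b * c) + a * ?T x (b * c)
      - (x * a + a * x) * b * (x * c + c * x) = ?e + ?e"
    by (simp add: algebra_simps)
  finally show "?e + ?e \<in> I" .
qed

text \<open>
  Let \<open>s\<^sub>k\<close> be the word with the square after the \<open>k\<close>-th of the four factors and \<open>s\<close> their sum.
  The previous lemma, with a further factor outside or with two factors merged into one, gives \<open>s - s\<^sub>k = 0\<close> for
  each of the five \<open>k\<close>. Summing these, \<open>5 s - s = 4 s = 0\<close>.
\<close>

lemma square_in_degree_six:
  assumes "x \<in> S" "a \<in> S" "b \<in> S" "c \<in> S" "d \<in> S"
  shows "x * x * a * b * c * d \<in> I" "a * x * x * b * c * d \<in> I" "a * b * x * x * c * d \<in> I"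
    "a * b * c * x * x * d \<in> I" "a * b * c * d * x * x \<in> I"
proof -
  let ?s0 = "x * x * a * b * c * d" and ?s1 = "a * x * x * b * c * d" and ?s2 = "a * b * x * x * c * d"
    and ?s3 = "a * b * c * x * x * d" and ?s4 = "a * b * c * d * x * x"
  let ?t = "?s0 + ?s1 + ?s2 + ?s3 + ?s4"
  have 0: "?t - ?s0 \<in> I"
    using I_left[OF assms(2) square_positions_three[OF assms(1,3,4,5)]] by (simp add: algebra_simps)
  have 4: "?t - ?s4 \<in> I"
    using I_right[OF square_positions_three[OF assms(1,2,3,4)] assms(5)] by (simp add: algebra_simps)
  have 1: "?t - ?s1 \<in> I"
    using square_positions_three[OF assms(1) S_mult[OF assms(2,3)] assms(4,5)] by (simp add: algebra_simps)
  have 2: "?t - ?s2 \<in> I"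
    using square_positions_three[OF assms(1,2) S_mult[OF assms(3,4)] assms(5)] by (simp add: algebra_simps)
  have 3: "?t - ?s3 \<in> I"
    using square_positions_three[OF assms(1,2,3) S_mult[OF assms(4,5)]] by (simp add: algebra_simps)
  have "(?t + ?t) + (?t + ?t) = (?t - ?s0) + (?t - ?s1) + (?t - ?s2) + (?t - ?s3) + (?t - ?s4)"
    by (simp add: algebra_simps)
  also have "\<dots> \<in> I" by (intro I_add 0 1 2 3 4)
  finally have s: "?t \<in> I" by (rule two[OF two])
  show "?s0 \<in> I" using I_diff[OF s 0] by simp
  show "?s1 \<in> I" using I_diff[OF s 1] by (simp add: algebra_simps)
  show "?s2 \<in> I" using I_diff[OF s 2] by (simp add: algebra_simps)
  show "?s3 \<in> I" using I_diff[OF s 3] by (simp add: algebra_simps)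
  show "?s4 \<in> I" using I_diff[OF s 4] by (simp add: algebra_simps)
qed

lemma alternating_in_degree_six:
  assumes "x \<in> S" "y \<in> S" "a \<in> S" "b \<in> S" "c \<in> S" "d \<in> S"
  shows "x * y * a * b * c * d + y * x * a * b * c * d \<in> I"
    "a * x * y * b * c * d + a * y * x * b * c * d \<in> I"
    "a * b * x * y * c * d + a * b * y * x * c * d \<in> I"
    "a * b * c * x * y * d + a * b * c * y * x * d \<in> I"
    "a * b * c * d * x * y + a * b * c * d * y * x \<in> I"
proof -
  note sq = square_in_degree_six[OF _ assms(3-6)]
  have p: "f (x + y) - f x - f y \<in> I" if "\<And>z. z \<in> S \<Longrightarrow> f z \<in> I" for f
    by (intro I_diff that S_add assms)
  show "x * y * a * b * c * d + y * x * a * b * c * d \<in> I"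
    using p[of "\<lambda>z. z * z * a * b * c * d", OF sq(1)] by (simp add: algebra_simps)
  show "a * x * y * b * c * d + a * y * x * b * c * d \<in> I"
    using p[of "\<lambda>z. a * z * z * b * c * d", OF sq(2)] by (simp add: algebra_simps)
  show "a * b * x * y * c * d + a * b * y * x * c * d \<in> I"
    using p[of "\<lambda>z. a * b * z * z * c * d", OF sq(3)] by (simp add: algebra_simps)
  show "a * b * c * x * y * d + a * b * c * y * x * d \<in> I"
    using p[of "\<lambda>z. a * b * c * z * z * d", OF sq(4)] by (simp add: algebra_simps)
  show "a * b * c * d * x * y + a * b * c * d * y * x \<in> I"
    using p[of "\<lambda>z. a * b * c * d * z * z", OF sq(5)] by (simp add: algebra_simps)
qed

text \<open>
  Swapping neighbours changes the sign, so swapping neighbouring pairs of factors does not change the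
  product: the six terms of the multilinear identity for \<open>ab\<close>, \<open>cd\<close>, \<open>ef\<close> agree.
\<close>

lemma product_of_six:
  assumes "a \<in> S" "b \<in> S" "c \<in> S" "d \<in> S" "e \<in> S" "f \<in> S"
  shows "a * b * c * d * e * f \<in> I"
proof -
  \<comment> \<open>Two sign changes cancel; two such steps move a pair past a pair.\<close>
  have trans: "u - w \<in> I" if "u + v \<in> I" "v + w \<in> I" for u v w
    using I_diff[OF that] by (simp add: algebra_simps)
  have chain: "u - w \<in> I" if "u - v \<in> I" "v - w \<in> I" for u v w
    using I_add[OF that] by (simp add: algebra_simps)
  have first: "a * b * c * d * e * f - c * d * a * b * e * f \<in> I"
    if "a \<in> S" "b \<in> S" "c \<in> S" "d \<in> S" "e \<in> S" "f \<in> S" for a b c d e f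
    by (rule chain[OF trans[OF alternating_in_degree_six(2,1)] trans[OF alternating_in_degree_six(3,2)]])
      (rule that)+
  have second: "a * b * c * d * e * f - a * b * e * f * c * d \<in> I"
    if "a \<in> S" "b \<in> S" "c \<in> S" "d \<in> S" "e \<in> S" "f \<in> S" for a b c d e f
    by (rule chain[OF trans[OF alternating_in_degree_six(4,3)] trans[OF alternating_in_degree_six(5,4)]])
      (rule that)+
  let ?p = "a * b * c * d * e * f"
  have 1: "?p - a * b * e * f * c * d \<in> I" by (rule second) (rule assms)+
  have 2: "?p - c * d * a * b * e * f \<in> I" by (rule first) (rule assms)+
  have 3: "?p - c * d * e * f * a * b \<in> I" by (rule chain[OF 2 second]) (rule assms)+
  have 4: "?p - e * f * a * b * c * d \<in> I" by (rule chain[OF 1 first]) (rule assms)+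
  have 5: "?p - e * f * c * d * a * b \<in> I" by (rule chain[OF 4 second]) (rule assms)+
  have sum: "(a * b) * (c * d) * (e * f) + (a * b) * (e * f) * (c * d) + (c * d) * (a * b) * (e * f)
      + (c * d) * (e * f) * (a * b) + (e * f) * (a * b) * (c * d) + (e * f) * (c * d) * (a * b) \<in> I"
    by (intro cube_multilinear S_mult assms)
  have "(?p + ?p) + (?p + ?p) + (?p + ?p) \<in> I"
    using I_add[OF sum I_add[OF 1 I_add[OF 2 I_add[OF 3 I_add[OF 4 5]]]]] by (simp add: algebra_simps)
  then show ?thesis by (rule two[OF three])
qed

end

section \<open>Words in the free algebra and the nilpotency degree\<close>

definition word :: "nat list \<Rightarrow> (nat free_monoid \<Rightarrow>\<^sub>0 'k::field)" where
  "word w = Poly_Mapping.single (FM w) 1"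

abbreviation scalar :: "'k \<Rightarrow> (nat free_monoid \<Rightarrow>\<^sub>0 'k::field)" where
  "scalar c \<equiv> Poly_Mapping.single 0 c"

lemma free_algebra_simps [simp]:
  "monoid.mult (free_algebra d) = (*)" "one (free_algebra d) = 1"
  "zero (free_algebra d) = 0" "add (free_algebra d) = (+)"
  by (simp_all add: free_algebra_def)

lemma carrier_free_algebra:
  "f \<in> carrier (free_algebra d) \<longleftrightarrow> (\<forall>w\<in>Poly_Mapping.keys f. set (letters w) \<subseteq> {..<d})"
  by (simp add: free_algebra_def)

lemma word_append: "word (u @ v) = word u * word v"
  by (simp add: word_def mult_single plus_free_monoid_def)

lemma word_Nil [simp]: "word [] = 1"
  by (simp add: word_def zero_free_monoid_def[symmetric])

lemma word_in_carrier: "set w \<subseteq> {..<d} \<Longrightarrow> word w \<in> carrier (free_algebra d)"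
  by (simp add: word_def carrier_free_algebra)

lemma scalar_in_carrier: "scalar c \<in> carrier (free_algebra d)"
  by (simp add: carrier_free_algebra zero_free_monoid_def)

lemma single_eq_scalar_word: "Poly_Mapping.single w c = scalar c * word (letters w)"
  by (simp add: word_def mult_single)

lemma sum_monomials:
  fixes f :: "nat free_monoid \<Rightarrow>\<^sub>0 'k::field"
  shows "f = (\<Sum>w\<in>Poly_Mapping.keys f. Poly_Mapping.single w (Poly_Mapping.lookup f w))"
proof (rule poly_mapping_eqI)
  fix v
  show "Poly_Mapping.lookup f v =
      Poly_Mapping.lookup (\<Sum>w\<in>Poly_Mapping.keys f. Poly_Mapping.single w (Poly_Mapping.lookup f w)) v"
    by (simp add: lookup_sum lookup_single when_def in_keys_iff)
qed

lemma scalar_commute: "f * scalar c = scalar c * (f :: nat free_monoid \<Rightarrow>\<^sub>0 'k::field)"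
proof -
  have "Poly_Mapping.single w a * scalar c = scalar c * Poly_Mapping.single w a"
    for w :: "nat free_monoid" and a
    by (simp add: mult_single mult.commute)
  then show ?thesis
    by (subst (1 2) sum_monomials) (simp add: sum_distrib_left sum_distrib_right)
qed

lemma letters_eq_Nil_iff: "letters w = [] \<longleftrightarrow> w = 0"
  by (cases w) (simp add: zero_free_monoid_def)

lemma free_algebra_sharp_iff:
  "f \<in> free_algebra_sharp d \<longleftrightarrow>
    (\<forall>w\<in>Poly_Mapping.keys f. set (letters w) \<subseteq> {..<d} \<and> letters w \<noteq> [])"
  by (auto simp: free_algebra_sharp_def carrier_free_algebra in_keys_iff letters_eq_Nil_iff)

lemma word_in_sharp: "set w \<subseteq> {..<d} \<Longrightarrow> w \<noteq> [] \<Longrightarrow> word w \<in> free_algebra_sharp d"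
  by (simp add: word_def free_algebra_sharp_iff)

lemma sharp_add: "f \<in> free_algebra_sharp d \<Longrightarrow> g \<in> free_algebra_sharp d \<Longrightarrow> f + g \<in> free_algebra_sharp d"
  using Poly_Mapping.keys_add[of f g] by (fastforce simp: free_algebra_sharp_iff)

lemma carrier_times_sharp:
  "f \<in> carrier (free_algebra d) \<Longrightarrow> g \<in> free_algebra_sharp d \<Longrightarrow> f * g \<in> free_algebra_sharp d"
  using keys_mult[of f g] by (fastforce simp: free_algebra_sharp_iff carrier_free_algebra plus_free_monoid_def)

lemma sharp_subset_carrier: "free_algebra_sharp d \<subseteq> carrier (free_algebra d)"
  by (auto simp: free_algebra_sharp_def)

lemma power_free_algebra: "f [^]\<^bsub>free_algebra d\<^esub> (3::nat) = f * f * f"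
  by (simp add: nat_pow_def numeral_3_eq_3)

context
  fixes n d :: nat
begin

lemma nil_ideal_zero: "0 \<in> nil_ideal n d"
  using additive_subgroup.zero_closed[OF ideal.axioms(1)[OF ideal_nil_ideal]] by simp

lemma nil_ideal_add: "f \<in> nil_ideal n d \<Longrightarrow> g \<in> nil_ideal n d \<Longrightarrow> f + g \<in> nil_ideal n d"
  using additive_subgroup.a_closed[OF ideal.axioms(1)[OF ideal_nil_ideal]] by simp

lemma nil_ideal_left: "r \<in> carrier (free_algebra d) \<Longrightarrow> f \<in> nil_ideal n d \<Longrightarrow> r * f \<in> nil_ideal n d"
  using ideal.I_l_closed[OF ideal_nil_ideal] by simp

lemma nil_ideal_right: "f \<in> nil_ideal n d \<Longrightarrow> r \<in> carrier (free_algebra d) \<Longrightarrow> f * r \<in> nil_ideal n d"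
  using ideal.I_r_closed[OF ideal_nil_ideal] by simp

lemma nil_ideal_scalar: "f \<in> nil_ideal n d \<Longrightarrow> scalar c * f \<in> nil_ideal n d"
  by (rule nil_ideal_left[OF scalar_in_carrier])

lemma nil_ideal_scalar_cancel:
  assumes "c \<noteq> 0" "scalar c * f \<in> nil_ideal n d"
  shows "f \<in> nil_ideal n d"
  using nil_ideal_scalar[OF assms(2), of "inverse c"] assms(1)
  by (simp add: mult.assoc[symmetric] mult_single)

lemma nil_ideal_minus: "f \<in> nil_ideal n d \<Longrightarrow> - f \<in> nil_ideal n d"
  using nil_ideal_scalar[of f "-1"] by (simp add: single_uminus)

lemma nil_ideal_diff: "f \<in> nil_ideal n d \<Longrightarrow> g \<in> nil_ideal n d \<Longrightarrow> f - g \<in> nil_ideal n d"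
  using nil_ideal_add[of f "- g"] nil_ideal_minus[of g] by simp

lemma nil_ideal_sum: "(\<And>x. x \<in> A \<Longrightarrow> g x \<in> nil_ideal n d) \<Longrightarrow> sum g A \<in> nil_ideal n d"
  by (induction A rule: infinite_finite_induct) (simp_all add: nil_ideal_zero nil_ideal_add)

lemma nil_ideal_word_mult:
  assumes "word w \<in> (nil_ideal n d :: (nat free_monoid \<Rightarrow>\<^sub>0 'k::field) set)" "set u \<subseteq> {..<d}" "set v \<subseteq> {..<d}"
  shows "word (u @ w @ v) \<in> (nil_ideal n d :: (nat free_monoid \<Rightarrow>\<^sub>0 'k) set)"
  using nil_ideal_left[OF word_in_carrier nil_ideal_right[OF assms(1) word_in_carrier]] assms
  by (simp add: word_append)

lemma nil_ideal_of_long: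
  fixes f :: "nat free_monoid \<Rightarrow>\<^sub>0 'k::field"
  assumes "\<And>w. set w \<subseteq> {..<d} \<Longrightarrow> length w = C \<Longrightarrow>
      word w \<in> (nil_ideal n d :: (nat free_monoid \<Rightarrow>\<^sub>0 'k) set)"
    and "f \<in> carrier (free_algebra d)" "\<And>w. w \<in> Poly_Mapping.keys f \<Longrightarrow> length (letters w) \<ge> C"
  shows "f \<in> nil_ideal n d"
proof -
  have "Poly_Mapping.single w (Poly_Mapping.lookup f w) \<in> nil_ideal n d" if "w \<in> Poly_Mapping.keys f" for w
  proof -
    have l: "set (letters w) \<subseteq> {..<d}" "length (letters w) \<ge> C" using that assms(2,3) by (auto simp: carrier_free_algebra)
    then have "word (take C (letters w)) \<in> (nil_ideal n d :: (nat free_monoid \<Rightarrow>\<^sub>0 'k) set)"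
      by (intro assms(1)) (use set_take_subset in \<open>fastforce\<close>, simp)
    then have "word ([] @ take C (letters w) @ drop C (letters w)) \<in> (nil_ideal n d :: (nat free_monoid \<Rightarrow>\<^sub>0 'k) set)"
      by (rule nil_ideal_word_mult) (use l set_drop_subset in \<open>fastforce+\<close>)
    then show ?thesis by (subst single_eq_scalar_word) (simp add: nil_ideal_scalar)
  qed
  then show ?thesis by (subst sum_monomials) (rule nil_ideal_sum)
qed

end

lemma positive_part_nil_algebra:
  fixes d :: nat
  defines "R \<equiv> free_algebra d :: (nat free_monoid \<Rightarrow>\<^sub>0 'k::field) ring"
  shows "positive_part (nil_algebra n d) (nil_component n d) \<subseteq> (\<lambda>f. nil_ideal n d +>\<^bsub>R\<^esub> f) ` free_algebra_sharp d"
proof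
  fix x assume "x \<in> positive_part (nil_algebra n d :: (nat free_monoid \<Rightarrow>\<^sub>0 'k) set ring) (nil_component n d)"
  then obtain a m where x: "x = finsum (nil_algebra n d) a {1..m}"
    and a: "\<And>j. j \<in> {1..m} \<Longrightarrow> a j \<in> (nil_component n d j :: (nat free_monoid \<Rightarrow>\<^sub>0 'k) set set)"
    by (auto simp: positive_part_def)
  let ?A = "nil_algebra n d :: (nat free_monoid \<Rightarrow>\<^sub>0 'k) set ring"
  let ?h = "\<lambda>f. nil_ideal n d +>\<^bsub>R\<^esub> f"
  interpret A: ring ?A by (rule ring_nil_algebra)
  interpret I: ideal "nil_ideal n d" R unfolding R_def by (rule ideal_nil_ideal)
  interpret h: ring_hom_ring R ?A ?h
    unfolding nil_algebra_def R_def[symmetric] by (rule I.rcos_ring_hom_ring)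
  have comp: "\<exists>f\<in>free_algebra_sharp d. a j = ?h f" if j: "j \<in> {1..m}" for j
  proof -
    have "a j \<in> ?h ` free_component d j"
      using a[OF j] by (simp add: nil_component_def R_def)
    moreover have "free_component d j \<subseteq> (free_algebra_sharp d :: (nat free_monoid \<Rightarrow>\<^sub>0 'k) set)"
      using j by (force simp: free_component_def free_algebra_sharp_iff carrier_free_algebra)
    ultimately show ?thesis by blast
  qed
  have "\<exists>f\<in>free_algebra_sharp d. finsum ?A a {1..k} = ?h f" if "k \<le> m" for k
    using that
  proof (induction k)
    case 0
    have "(0 :: nat free_monoid \<Rightarrow>\<^sub>0 'k) \<in> free_algebra_sharp d" by (simp add: free_algebra_sharp_iff)
    moreover have "?h 0 = \<zero>\<^bsub>?A\<^esub>" using h.hom_zero by (simp add: R_def)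
    ultimately show ?case by (intro bexI[of _ 0]) auto
  next
    case (Suc k)
    then obtain f where f: "f \<in> free_algebra_sharp d" "finsum ?A a {1..k} = ?h f" by auto
    obtain g where g: "g \<in> free_algebra_sharp d" "a (Suc k) = ?h g" using comp[of "Suc k"] Suc.prems by auto
    have mem: "a j \<in> carrier ?A" if j: "j \<in> {1..m}" for j
    proof -
      obtain e where e: "e \<in> free_algebra_sharp d" "a j = ?h e" using comp[OF j] by (elim bexE)
      have "e \<in> carrier R" unfolding R_def using e(1) by (rule subsetD[OF sharp_subset_carrier])
      then show ?thesis unfolding e(2) by (rule h.hom_closed)
    qed
    have fg: "f \<in> carrier R" "g \<in> carrier R"
      using f(1) g(1) subsetD[OF sharp_subset_carrier] by (auto simp: R_def)
    have "finsum ?A a {1..Suc k} = finsum ?A a (insert (Suc k) {1..k})"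
      by (simp add: atLeastAtMostSuc_conv)
    also have "\<dots> = a (Suc k) \<oplus>\<^bsub>?A\<^esub> finsum ?A a {1..k}"
      by (intro A.finsum_insert) (use Suc.prems mem in auto)
    also have "\<dots> = ?h (g + f)"
      using h.hom_add[OF fg(2,1)] f(2) g(2) by (simp add: R_def)
    finally show ?case using sharp_add[OF g(1) f(1)] by (intro bexI)
  qed
  then show "x \<in> ?h ` free_algebra_sharp d" using x by blast
qed

lemma nil_algebra_degree_le:
  assumes "\<And>w. set w \<subseteq> {..<d} \<Longrightarrow> length w = C \<Longrightarrow>
      word w \<in> (nil_ideal n d :: (nat free_monoid \<Rightarrow>\<^sub>0 'k::field) set)"
  shows "nil_algebra_degree n d TYPE('k) \<le> enat C"
proof -
  let ?R = "free_algebra d :: (nat free_monoid \<Rightarrow>\<^sub>0 'k) ring"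
  let ?A = "nil_algebra n d :: (nat free_monoid \<Rightarrow>\<^sub>0 'k) set ring"
  let ?h = "\<lambda>f. nil_ideal n d +>\<^bsub>?R\<^esub> f"
  interpret R: ring ?R by (rule ring_free_algebra)
  interpret I: ideal "nil_ideal n d" ?R by (rule ideal_nil_ideal)
  interpret h: ring_hom_ring ?R ?A ?h
    unfolding nil_algebra_def by (rule I.rcos_ring_hom_ring)
  have prod: "\<exists>f\<in>carrier ?R. foldr (\<otimes>\<^bsub>?A\<^esub>) as \<one>\<^bsub>?A\<^esub> = ?h f \<and> (\<forall>w\<in>Poly_Mapping.keys f. length (letters w) \<ge> length as)"
    if "set as \<subseteq> ?h ` free_algebra_sharp d" for as
    using that
  proof (induction as)
    case Nil
    show ?case using h.hom_one R.one_closed by (intro bexI[of _ 1]) auto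
  next
    case (Cons a as)
    then obtain f where f: "f \<in> carrier ?R" "foldr (\<otimes>\<^bsub>?A\<^esub>) as \<one>\<^bsub>?A\<^esub> = ?h f"
      "\<And>w. w \<in> Poly_Mapping.keys f \<Longrightarrow> length (letters w) \<ge> length as" by auto
    obtain g where g: "g \<in> free_algebra_sharp d" "a = ?h g" using Cons.prems by auto
    have gc: "g \<in> carrier ?R" using g sharp_subset_carrier by blast
    have "length (letters w) \<ge> length (a # as)" if "w \<in> Poly_Mapping.keys (g * f)" for w
    proof -
      obtain u v where "u \<in> Poly_Mapping.keys g" "v \<in> Poly_Mapping.keys f" "w = u + v"
        using keys_mult[of g f] \<open>w \<in> Poly_Mapping.keys (g * f)\<close> by blast
      then show ?thesis
        using f(3)[of v] g(1) by (cases "letters u") (auto simp: plus_free_monoid_def free_algebra_sharp_iff)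
    qed
    moreover have "foldr (\<otimes>\<^bsub>?A\<^esub>) (a # as) \<one>\<^bsub>?A\<^esub> = ?h (g * f)"
      using f g gc h.hom_mult[of g f] by simp
    moreover have "g * f \<in> carrier ?R" using R.m_closed[OF gc f(1)] by simp
    ultimately show ?case by blast
  qed
  have "foldr (\<otimes>\<^bsub>?A\<^esub>) as \<one>\<^bsub>?A\<^esub> = \<zero>\<^bsub>?A\<^esub>"
    if as: "length as = C" "set as \<subseteq> positive_part ?A (nil_component n d)" for as
  proof -
    obtain f where f: "f \<in> carrier ?R" "foldr (\<otimes>\<^bsub>?A\<^esub>) as \<one>\<^bsub>?A\<^esub> = ?h f"
      "\<And>w. w \<in> Poly_Mapping.keys f \<Longrightarrow> length (letters w) \<ge> C"
      using prod[OF subset_trans[OF as(2) positive_part_nil_algebra]] as(1) by auto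
    have "f \<in> nil_ideal n d" by (rule nil_ideal_of_long[OF assms f(1,3)])
    then show ?thesis unfolding f(2) by (simp add: I.a_rcos_const nil_algebra_def FactRing_def)
  qed
  then show ?thesis
    unfolding nil_algebra_degree_def nilpotency_degree_def by (intro Inf_lower) blast
qed

text \<open>
  If all products of \<open>C\<close> elements vanished for some \<open>C\<close> not above the length of \<open>w\<close>, then so would the
  product of the first \<open>C\<close> letters of \<open>w\<close>, and with it \<open>w\<close>.
\<close>

lemma nil_algebra_degree_gt:
  assumes "set w \<subseteq> {..<d}" "word w \<notin> (nil_ideal n d :: (nat free_monoid \<Rightarrow>\<^sub>0 'k::field) set)"
  shows "enat (Suc (length w)) \<le> nil_algebra_degree n d TYPE('k)"
proof -
  let ?R = "free_algebra d :: (nat free_monoid \<Rightarrow>\<^sub>0 'k) ring"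
  let ?A = "nil_algebra n d :: (nat free_monoid \<Rightarrow>\<^sub>0 'k) set ring"
  let ?h = "\<lambda>f. nil_ideal n d +>\<^bsub>?R\<^esub> f"
  interpret A: ring ?A by (rule ring_nil_algebra)
  interpret R: ring ?R by (rule ring_free_algebra)
  interpret I: ideal "nil_ideal n d" ?R by (rule ideal_nil_ideal)
  interpret h: ring_hom_ring ?R ?A ?h
    unfolding nil_algebra_def by (rule I.rcos_ring_hom_ring)
  have letter: "?h (word [i]) \<in> positive_part ?A (nil_component n d)" if "i < d" for i
  proof -
    have c: "?h (word [i]) \<in> carrier ?A" by (rule h.hom_closed) (rule word_in_carrier, use that in simp)
    have "?h (word [i]) \<in> nil_component n d 1"
      unfolding nil_component_def
      by (rule imageI) (use that word_in_carrier[of "[i]" d] in \<open>simp add: free_component_def word_def\<close>)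
    then have "finsum ?A (\<lambda>_. ?h (word [i])) {1..1::nat} \<in> positive_part ?A (nil_component n d)"
      unfolding positive_part_def by (intro CollectI exI[of _ "\<lambda>_. ?h (word [i])"] exI[of _ 1]) simp
    then show ?thesis using c by simp
  qed
  have prod: "foldr (\<otimes>\<^bsub>?A\<^esub>) (map (\<lambda>i. ?h (word [i])) u) \<one>\<^bsub>?A\<^esub> = ?h (word u)" if "set u \<subseteq> {..<d}" for u
    using that
  proof (induction u)
    case Nil
    show ?case using h.hom_one by simp
  next
    case (Cons i u)
    then show ?case
      using h.hom_mult[of "word [i]" "word u"] word_in_carrier[of "[i]" d, where ?'a = 'k] word_in_carrier[of u d, where ?'a = 'k]
        word_append[of "[i]" u, where ?'a = 'k] by simp
  qed
  have "enat (Suc (length w)) \<le> enat C"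
    if C: "\<forall>as. length as = C \<and> set as \<subseteq> positive_part ?A (nil_component n d) \<longrightarrow> foldr (\<otimes>\<^bsub>?A\<^esub>) as \<one>\<^bsub>?A\<^esub> = \<zero>\<^bsub>?A\<^esub>" for C
  proof (rule ccontr)
    assume "\<not> enat (Suc (length w)) \<le> enat C"
    then have len: "C \<le> length w" by simp
    let ?u = "take C w"
    have u: "set ?u \<subseteq> {..<d}" "set (drop C w) \<subseteq> {..<d}" using assms(1) set_take_subset set_drop_subset by fastforce+
    have "?h (word ?u) = \<zero>\<^bsub>?A\<^esub>"
      unfolding prod[OF u(1), symmetric]
      by (rule C[rule_format]) (use len u letter in auto)
    then have "?h (word ?u) = nil_ideal n d" by (simp add: nil_algebra_def FactRing_def)
    then have "word ?u \<in> (nil_ideal n d :: (nat free_monoid \<Rightarrow>\<^sub>0 'k) set)"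
      using I.a_rcos_self[OF word_in_carrier[OF u(1)]] by simp
    from nil_ideal_word_mult[OF this _ u(2), of "[]"] show False using assms(2) by simp
  qed
  then show ?thesis
    unfolding nil_algebra_degree_def nilpotency_degree_def by (intro Inf_greatest) blast
qed

section \<open>The nil ideal of exponent three\<close>

lemma nil_ideal_cube: "f \<in> free_algebra_sharp d \<Longrightarrow> f * f * f \<in> nil_ideal 3 d"
proof -
  assume f: "f \<in> free_algebra_sharp d"
  interpret ring "free_algebra d" by (rule ring_free_algebra)
  have "{f [^]\<^bsub>free_algebra d\<^esub> (3::nat) |f. f \<in> free_algebra_sharp d} \<subseteq> nil_ideal 3 d"
    unfolding nil_ideal_def by (rule genideal_self) (use sharp_subset_carrier in auto)
  then show ?thesis using f power_free_algebra[of d f] by force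
qed

text \<open>
  The parts of \<open>(g + c f)\<^sup>3\<close> that are linear and quadratic in \<open>c\<close> can be separated with one scalar
  \<open>c \<noteq> 0, 1\<close> besides \<open>c = 1\<close>.
\<close>

lemma nil_ideal_cube_linear:
  fixes f g :: "nat free_monoid \<Rightarrow>\<^sub>0 'k::field"
  assumes inf: "infinite (UNIV :: 'k set)"
    and f: "f \<in> free_algebra_sharp d" and g: "g \<in> free_algebra_sharp d"
  shows "f * f * g + f * g * f + g * f * f \<in> nil_ideal 3 d"
proof -
  have "infinite (UNIV - {0, 1 :: 'k})" using inf by simp
  then obtain c :: 'k where c: "c \<noteq> 0" "c \<noteq> 1" by (metis Diff_iff ex_in_conv finite.emptyI insertI1 insertI2)
  let ?T = "\<lambda>a b. a * a * b + a * b * a + b * a * (a :: nat free_monoid \<Rightarrow>\<^sub>0 'k)"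
  let ?C = "scalar c"
  note com = scalar_commute[of f c] scalar_commute[of g c]
  have left_com: "f * (?C * h) = ?C * (f * h)" "g * (?C * h) = ?C * (g * h)" for h
    by (simp_all add: mult.assoc[symmetric] com)
  have *: "(h + k) * (h + k) * (h + k) - h * h * h - k * k * k \<in> nil_ideal 3 d"
    if "h \<in> free_algebra_sharp d" "k \<in> free_algebra_sharp d" for h k :: "nat free_monoid \<Rightarrow>\<^sub>0 'k"
    by (intro nil_ideal_diff nil_ideal_cube sharp_add that)
  have "(g + f) * (g + f) * (g + f) - g * g * g - f * f * f = ?T f g + ?T g f"
    by (simp add: algebra_simps)
  then have 1: "?T f g + ?T g f \<in> nil_ideal 3 d" using *[OF g f] by simp
  have eq: "(g + ?C * f) * (g + ?C * f) * (g + ?C * f) - g * g * g - (?C * f) * (?C * f) * (?C * f) =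
      ?C * ?C * ?T f g + ?C * ?T g f"
    by (simp add: algebra_simps com left_com)
  have 2: "?C * ?C * ?T f g + ?C * ?T g f \<in> nil_ideal 3 d"
    using *[OF g carrier_times_sharp[OF scalar_in_carrier f]] unfolding eq[symmetric] .
  have "?C * ?C * ?T f g + ?C * ?T g f - ?C * (?T f g + ?T g f) = (?C * ?C - ?C) * ?T f g"
    by (simp add: algebra_simps)
  also have "?C * ?C - ?C = scalar (c * (c - 1))"
    by (simp add: mult_single single_diff[symmetric] algebra_simps)
  finally have "scalar (c * (c - 1)) * ?T f g \<in> nil_ideal 3 d"
    using nil_ideal_diff[OF 2 nil_ideal_scalar[OF 1, of c]] by simp
  then show ?thesis by (rule nil_ideal_scalar_cancel[rotated]) (use c in simp)
qed

lemma nil_cube_ideal_nil_ideal: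
  assumes "infinite (UNIV :: 'k::field set)"
  shows "nil_cube_ideal (free_algebra_sharp d) (nil_ideal 3 d :: (nat free_monoid \<Rightarrow>\<^sub>0 'k) set)"
proof
  fix r a :: "nat free_monoid \<Rightarrow>\<^sub>0 'k"
  assume "r \<in> free_algebra_sharp d"
  then have r: "r \<in> carrier (free_algebra d)" using sharp_subset_carrier by blast
  show "r * a \<in> free_algebra_sharp d" if "a \<in> free_algebra_sharp d"
    using r that by (rule carrier_times_sharp)
  show "r * a \<in> nil_ideal 3 d" if "a \<in> nil_ideal 3 d" using r that by (rule nil_ideal_left)
  show "a * r \<in> nil_ideal 3 d" if "a \<in> nil_ideal 3 d" using that r by (rule nil_ideal_right)
qed (simp_all add: sharp_add nil_ideal_add nil_ideal_minus nil_ideal_cube_linear[OF assms])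

lemma nil_ideal_three_cancel:
  assumes "(3 :: 'k::field) \<noteq> 0" "f + f + f \<in> (nil_ideal n d :: (nat free_monoid \<Rightarrow>\<^sub>0 'k) set)"
  shows "f \<in> nil_ideal n d"
proof (rule nil_ideal_scalar_cancel)
  have "(1 + 1 + 1) * f \<in> nil_ideal n d" using assms(2) unfolding distrib_right mult_1 .
  then show "scalar 3 * f \<in> nil_ideal n d" by simp
qed (rule assms(1))

lemma nil_ideal_two_cancel:
  assumes "(2 :: 'k::field) \<noteq> 0" "f + f \<in> (nil_ideal n d :: (nat free_monoid \<Rightarrow>\<^sub>0 'k) set)"
  shows "f \<in> nil_ideal n d"
proof (rule nil_ideal_scalar_cancel)
  show "scalar 2 * f \<in> nil_ideal n d" using assms(2) by (simp add: mult_2)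
qed (rule assms(1))

lemma word_in_nil_ideal_6:
  assumes "infinite (UNIV :: 'k::field set)" "(2::'k) \<noteq> 0" "(3::'k) \<noteq> 0" "set w \<subseteq> {..<d}" "length w = 6"
  shows "word w \<in> (nil_ideal 3 d :: (nat free_monoid \<Rightarrow>\<^sub>0 'k) set)"
proof -
  interpret nil_cube_ideal "free_algebra_sharp d" "nil_ideal 3 d :: (nat free_monoid \<Rightarrow>\<^sub>0 'k) set"
    by (rule nil_cube_ideal_nil_ideal[OF assms(1)])
  interpret nil_cube_ideal_6 "free_algebra_sharp d" "nil_ideal 3 d :: (nat free_monoid \<Rightarrow>\<^sub>0 'k) set"
    by unfold_locales (rule nil_ideal_two_cancel[OF assms(2)] nil_ideal_three_cancel[OF assms(3)], assumption)+
  obtain a b c e f g where w: "w = [a] @ [b] @ [c] @ [e] @ [f] @ [g]"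
    using assms(5) by (auto simp: numeral_eq_Suc length_Suc_conv)
  have "word [a] * word [b] * word [c] * word [e] * word [f] * word [g] \<in>
      (nil_ideal 3 d :: (nat free_monoid \<Rightarrow>\<^sub>0 'k) set)"
    by (rule product_of_six) (use assms(4) in \<open>auto simp: w intro!: word_in_sharp\<close>)
  then show ?thesis by (simp add: w word_append[symmetric])
qed

text \<open>
  Words with foreign letters count as null, which spares side conditions on the alphabet in the
  rewriting arguments.
\<close>

definition null_word :: "'k::field itself \<Rightarrow> nat \<Rightarrow> nat list \<Rightarrow> bool" where
  "null_word _ d w \<longleftrightarrow> (set w \<subseteq> {..<d} \<longrightarrow> word w \<in> (nil_ideal 3 d :: (nat free_monoid \<Rightarrow>\<^sub>0 'k) set))"

lemma null_words_null_word:
  assumes inf: "infinite (UNIV :: 'k::field set)"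
  shows "null_words (null_word TYPE('k) d)"
proof
  fix u w v assume "null_word TYPE('k) d w"
  then show "null_word TYPE('k) d (u @ w @ v)"
    unfolding null_word_def by (simp add: nil_ideal_word_mult)
next
  fix x
  show "null_word TYPE('k) d [x, x, x]"
    unfolding null_word_def
  proof
    assume "set [x, x, x] \<subseteq> {..<d}"
    then have "word [x] * word [x] * word [x] \<in> (nil_ideal 3 d :: (nat free_monoid \<Rightarrow>\<^sub>0 'k) set)"
      by (intro nil_ideal_cube word_in_sharp) auto
    then show "word [x, x, x] \<in> (nil_ideal 3 d :: (nat free_monoid \<Rightarrow>\<^sub>0 'k) set)"
      by (simp add: word_append[symmetric])
  qed
next
  fix u v t :: "nat list" and x
  let ?I = "nil_ideal 3 d :: (nat free_monoid \<Rightarrow>\<^sub>0 'k) set"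
  let ?N = "null_word TYPE('k) d"
  let ?a = "u @ [x, x] @ v @ t" and ?b = "u @ [x] @ v @ [x] @ t" and ?c = "u @ v @ [x, x] @ t"
  have same: "?N w \<longleftrightarrow> (set ?a \<subseteq> {..<d} \<longrightarrow> word w \<in> ?I)" if "set w = set ?a" for w
    using that by (simp add: null_word_def)
  have sum: "word ?a + word ?b + word ?c \<in> ?I" if "set ?a \<subseteq> {..<d}" "v \<noteq> []"
  proof -
    have "word [x] * word [x] * word v + word [x] * word v * word [x] + word v * word [x] * word [x] \<in> ?I"
      by (intro nil_ideal_cube_linear[OF inf] word_in_sharp) (use that in auto)
    then have "word u * (word [x] * word [x] * word v + word [x] * word v * word [x] + word v * word [x] * word [x]) * word t \<in> ?I"
      by (intro nil_ideal_left nil_ideal_right word_in_carrier) (use that in auto)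
    then show ?thesis
      by (simp add: distrib_left distrib_right word_append[symmetric])
  qed
  have set_eqs: "set ?b = set ?a" "set ?c = set ?a" by auto
  show "?N ?b" if "?N ?a" "?N ?c"
  proof (cases "v = []")
    case True
    then show ?thesis using that by simp
  next
    case False
    have "word ?b \<in> ?I" if "set ?a \<subseteq> {..<d}" "word ?a \<in> ?I" "word ?c \<in> ?I"
      using nil_ideal_diff[OF nil_ideal_diff[OF sum[OF that(1) False] that(2)] that(3)] by simp
    then show ?thesis using that same[OF refl] same[OF set_eqs(1)] same[OF set_eqs(2)] by blast
  qed
  show "?N ?a" if "v \<noteq> []" "?N ?b" "?N ?c"
  proof -
    have "word ?a \<in> ?I" if "set ?a \<subseteq> {..<d}" "word ?b \<in> ?I" "word ?c \<in> ?I"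
      using nil_ideal_diff[OF nil_ideal_diff[OF sum[OF that(1) \<open>v \<noteq> []\<close>] that(2)] that(3)] by (simp add: algebra_simps)
    then show ?thesis using that same[OF refl] same[OF set_eqs(1)] same[OF set_eqs(2)] by blast
  qed
  show "?N ?c" if "v \<noteq> []" "?N ?b" "?N ?a"
  proof -
    have "word ?c \<in> ?I" if "set ?a \<subseteq> {..<d}" "word ?b \<in> ?I" "word ?a \<in> ?I"
      using nil_ideal_diff[OF nil_ideal_diff[OF sum[OF that(1) \<open>v \<noteq> []\<close>] that(2)] that(3)] by (simp add: algebra_simps)
    then show ?thesis using that same[OF refl] same[OF set_eqs(1)] same[OF set_eqs(2)] by blast
  qed
qed

lemma null_words_separated_null_word:
  assumes inf: "infinite (UNIV :: 'k::field set)" and three: "(3::'k) \<noteq> 0"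
  shows "null_words_separated (null_word TYPE('k) d)"
proof (intro null_words_separated.intro null_words_separated_axioms.intro)
  show "null_words (null_word TYPE('k) d)" by (rule null_words_null_word[OF inf])
  fix x y and z :: "nat list" assume z: "z \<noteq> []"
  let ?I = "nil_ideal 3 d :: (nat free_monoid \<Rightarrow>\<^sub>0 'k) set"
  have "word ([x, x] @ z @ [y, y]) \<in> ?I" if s: "set ([x, x] @ z @ [y, y]) \<subseteq> {..<d}"
  proof -
    have sharp: "word [x] \<in> free_algebra_sharp d" "word [y] \<in> free_algebra_sharp d" "word z \<in> free_algebra_sharp d"
      using s z by (auto intro!: word_in_sharp)
    have "word [x] * word [x] * word z * word [y] * word [y] \<in> ?I"
      by (rule nil_ideal_three_cancel[OF three])
        (rule nil_cube_ideal.triple_separated_squares[OF nil_cube_ideal_nil_ideal[OF inf] sharp])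
    then show ?thesis by (simp add: word_append[symmetric])
  qed
  then show "null_word TYPE('k) d ([x, x] @ z @ [y, y])" unfolding null_word_def by blast
qed

section \<open>Functionals that vanish on the nil ideal\<close>

definition linear_extension :: "(nat list \<Rightarrow> 'k) \<Rightarrow> (nat free_monoid \<Rightarrow>\<^sub>0 'k::field) \<Rightarrow> 'k" where
  "linear_extension \<phi> f = (\<Sum>w\<in>Poly_Mapping.keys f. Poly_Mapping.lookup f w * \<phi> (letters w))"

lemma linear_extension_superset:
  "finite A \<Longrightarrow> Poly_Mapping.keys f \<subseteq> A \<Longrightarrow>
    linear_extension \<phi> f = (\<Sum>w\<in>A. Poly_Mapping.lookup f w * \<phi> (letters w))"
  unfolding linear_extension_def by (rule sum.mono_neutral_left) (auto simp: in_keys_iff)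

lemma linear_extension_add: "linear_extension \<phi> (f + g) = linear_extension \<phi> f + linear_extension \<phi> g"
proof -
  let ?A = "Poly_Mapping.keys f \<union> Poly_Mapping.keys g"
  have "linear_extension \<phi> h = (\<Sum>w\<in>?A. Poly_Mapping.lookup h w * \<phi> (letters w))"
    if "h \<in> {f, g, f + g}" for h
    by (rule linear_extension_superset) (use that Poly_Mapping.keys_add[of f g] in auto)
  then show ?thesis by (simp add: lookup_add distrib_right sum.distrib)
qed

lemma linear_extension_zero [simp]: "linear_extension \<phi> 0 = 0"
  by (simp add: linear_extension_def)

lemma linear_extension_single [simp]: "linear_extension \<phi> (Poly_Mapping.single w c) = c * \<phi> (letters w)"
  by (simp add: linear_extension_def)

lemma linear_extension_minus: "linear_extension \<phi> (- f) = - linear_extension \<phi> f"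
  using linear_extension_add[of \<phi> f "- f"] by (simp add: eq_neg_iff_add_eq_0 add.commute)

lemma linear_extension_sum: "linear_extension \<phi> (sum g A) = (\<Sum>x\<in>A. linear_extension \<phi> (g x))"
  by (induction A rule: infinite_finite_induct) (simp_all add: linear_extension_add)

lemma linear_extension_scalar: "linear_extension \<phi> (scalar c * f) = c * linear_extension \<phi> f"
proof -
  have "linear_extension \<phi> (scalar c * Poly_Mapping.single w a) = c * linear_extension \<phi> (Poly_Mapping.single w a)" for w a
    by (simp add: mult_single)
  then show ?thesis
    by (subst (1 2) sum_monomials[of f]) (simp only: sum_distrib_left linear_extension_sum)
qed

text \<open>
  An ideal on which the functional vanishes. Multiplications by words on both sides are built in, so that
  only the generators of the nil ideal remain to be checked.
\<close>

definition functional_ideal :: "nat \<Rightarrow> (nat list \<Rightarrow> 'k::field) \<Rightarrow> (nat free_monoid \<Rightarrow>\<^sub>0 'k) set" where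
  "functional_ideal d \<phi> =
    {f \<in> carrier (free_algebra d). \<forall>u v. linear_extension \<phi> (word u * f * word v) = 0}"

lemma functional_ideal_add:
  "f \<in> functional_ideal d \<phi> \<Longrightarrow> g \<in> functional_ideal d \<phi> \<Longrightarrow> f + g \<in> functional_ideal d \<phi>"
  using ring.ring_simprules(1)[OF ring_free_algebra, of f d g]
  by (simp add: functional_ideal_def distrib_left distrib_right linear_extension_add)

lemma functional_ideal_minus: "f \<in> functional_ideal d \<phi> \<Longrightarrow> - f \<in> functional_ideal d \<phi>"
  by (simp add: functional_ideal_def carrier_free_algebra linear_extension_minus)

lemma ideal_functional_ideal:
  fixes \<phi> :: "nat list \<Rightarrow> 'k::field"
  shows "ideal (functional_ideal d \<phi>) (free_algebra d)"
proof -
  let ?J = "functional_ideal d \<phi>"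
  interpret ring "free_algebra d :: (nat free_monoid \<Rightarrow>\<^sub>0 'k) ring" by (rule ring_free_algebra)
  have inv: "\<ominus>\<^bsub>free_algebra d\<^esub> f = - f" if "f \<in> carrier (free_algebra d)" for f :: "nat free_monoid \<Rightarrow>\<^sub>0 'k"
    by (rule minus_equality) (use that in \<open>simp_all add: carrier_free_algebra\<close>)
  show ?thesis
  proof (rule idealI[OF ring_free_algebra])
    show "subgroup ?J (add_monoid (free_algebra d))"
    proof (rule add.subgroupI)
      show "?J \<subseteq> carrier (free_algebra d)" by (auto simp: functional_ideal_def)
      have "0 \<in> ?J" by (simp add: functional_ideal_def carrier_free_algebra)
      then show "?J \<noteq> {}" by blast
      show "\<ominus>\<^bsub>free_algebra d\<^esub> f \<in> ?J" if "f \<in> ?J" for f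
        using that functional_ideal_minus[OF that] by (subst inv) (auto simp: functional_ideal_def)
      show "f \<oplus>\<^bsub>free_algebra d\<^esub> g \<in> ?J" if "f \<in> ?J" "g \<in> ?J" for f g
        using functional_ideal_add[OF that] by simp
    qed
  next
    fix f r :: "nat free_monoid \<Rightarrow>\<^sub>0 'k" assume f: "f \<in> ?J" and r: "r \<in> carrier (free_algebra d)"
    have fc: "f \<in> carrier (free_algebra d)" using f by (simp add: functional_ideal_def)
    let ?m = "\<lambda>w. Poly_Mapping.single w (Poly_Mapping.lookup r w)"
    have z: "linear_extension \<phi> (word u * f * word v) = 0" for u v
      using f by (simp add: functional_ideal_def)
    have "linear_extension \<phi> (word u * (?m w * f) * word v) = 0" for u v w
    proof -
      have "word u * (?m w * f) * word v = scalar (Poly_Mapping.lookup r w) * (word (u @ letters w) * f * word v)"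
        by (subst single_eq_scalar_word) (simp add: word_append mult.assoc[symmetric] scalar_commute)
      then show ?thesis using z by (simp add: linear_extension_scalar)
    qed
    then have "linear_extension \<phi> (word u * (r * f) * word v) = 0" for u v
      by (subst sum_monomials[of r]) (simp add: sum_distrib_left sum_distrib_right linear_extension_sum)
    then show "r \<otimes>\<^bsub>free_algebra d\<^esub> f \<in> ?J"
      using m_closed[OF r fc] by (simp add: functional_ideal_def)
    have "linear_extension \<phi> (word u * (f * ?m w) * word v) = 0" for u v w
    proof -
      have "word u * (f * ?m w) * word v = scalar (Poly_Mapping.lookup r w) * (word u * f * word (letters w @ v))"
        by (subst single_eq_scalar_word)
          (simp add: word_append mult.assoc[symmetric] scalar_commute[of "word u * f"] scalar_commute[of "word u"])
      then show ?thesis using z by (simp add: linear_extension_scalar)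
    qed
    then have "linear_extension \<phi> (word u * (f * r) * word v) = 0" for u v
      by (subst sum_monomials[of r]) (simp add: sum_distrib_left sum_distrib_right linear_extension_sum)
    then show "f \<otimes>\<^bsub>free_algebra d\<^esub> r \<in> ?J"
      using m_closed[OF fc r] by (simp add: functional_ideal_def)
  qed
qed

lemma sharp_induct [consumes 1, case_names zero single add]:
  fixes f :: "nat free_monoid \<Rightarrow>\<^sub>0 'k::field"
  assumes "f \<in> free_algebra_sharp d" "P 0"
    and "\<And>w c. set w \<subseteq> {..<d} \<Longrightarrow> w \<noteq> [] \<Longrightarrow> P (Poly_Mapping.single (FM w) c)"
    and "\<And>f g. f \<in> free_algebra_sharp d \<Longrightarrow> g \<in> free_algebra_sharp d \<Longrightarrow> P f \<Longrightarrow> P g \<Longrightarrow> P (f + g)"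
  shows "P f"
proof -
  let ?m = "\<lambda>w. Poly_Mapping.single w (Poly_Mapping.lookup f w)"
  have m: "?m w \<in> free_algebra_sharp d \<and> P (?m w)" if "w \<in> Poly_Mapping.keys f" for w
  proof -
    have w: "set (letters w) \<subseteq> {..<d}" "letters w \<noteq> []"
      using assms(1) that unfolding free_algebra_sharp_iff by blast+
    have "?m w \<in> free_algebra_sharp d" unfolding free_algebra_sharp_iff using w by simp
    then show ?thesis using assms(3)[OF w, of "Poly_Mapping.lookup f w"] by simp
  qed
  have "sum ?m A \<in> free_algebra_sharp d \<and> P (sum ?m A)" if "A \<subseteq> Poly_Mapping.keys f" for A
    using finite_subset[OF that finite_keys] that
  proof (induction A rule: finite_induct)
    case empty
    show ?case using assms(2) by (simp add: free_algebra_sharp_iff)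
  next
    case (insert w A)
    then show ?case using m[of w] by (simp add: sharp_add assms(4))
  qed
  from this[of "Poly_Mapping.keys f"] show ?thesis using sum_monomials[of f] by simp
qed

lemma carrier_closed:
  "f \<in> carrier (free_algebra d) \<Longrightarrow> g \<in> carrier (free_algebra d) \<Longrightarrow> f + g \<in> carrier (free_algebra d)"
  "f \<in> carrier (free_algebra d) \<Longrightarrow> g \<in> carrier (free_algebra d) \<Longrightarrow> f * g \<in> carrier (free_algebra d)"
  using ring.ring_simprules(1,5)[OF ring_free_algebra, of f d g] by simp_all

lemma single_in_carrier: "set w \<subseteq> {..<d} \<Longrightarrow> Poly_Mapping.single (FM w) c \<in> carrier (free_algebra d)"
  by (simp add: carrier_free_algebra)

text \<open>
  It is enough that the functional kills the cube identity and its linearizations on words. In characteristic two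
  and three the multilinear identity does not imply both of the others, so all three have to be checked.
\<close>

locale cube_functional =
  fixes \<phi> :: "nat list \<Rightarrow> 'k::field"
  assumes cube: "a \<noteq> [] \<Longrightarrow> \<phi> (u @ a @ a @ a @ v) = 0"
    and cube_linear: "a \<noteq> [] \<Longrightarrow> b \<noteq> [] \<Longrightarrow>
      \<phi> (u @ a @ a @ b @ v) + \<phi> (u @ a @ b @ a @ v) + \<phi> (u @ b @ a @ a @ v) = 0"
    and cube_multilinear: "a \<noteq> [] \<Longrightarrow> b \<noteq> [] \<Longrightarrow> c \<noteq> [] \<Longrightarrow>
      \<phi> (u @ a @ b @ c @ v) + \<phi> (u @ a @ c @ b @ v) + \<phi> (u @ b @ a @ c @ v) +
      \<phi> (u @ b @ c @ a @ v) + \<phi> (u @ c @ a @ b @ v) + \<phi> (u @ c @ b @ a @ v) = 0"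
begin

abbreviation "J d \<equiv> functional_ideal d \<phi>"

abbreviation "T3 a b c \<equiv> a * b * c + a * c * b + b * a * c + b * c * a + c * a * b + c * b * (a :: nat free_monoid \<Rightarrow>\<^sub>0 'k)"
abbreviation "T2 a b \<equiv> a * a * b + a * b * a + b * a * (a :: nat free_monoid \<Rightarrow>\<^sub>0 'k)"

lemma zero_in_J: "0 \<in> J d"
  by (simp add: functional_ideal_def carrier_free_algebra)

text \<open>
  From words to all elements: the multilinear identity extends by additivity in each argument. The
  identity that is quadratic in its first argument then extends since its polarization is the multilinear one,
  and the cube in the same way.
\<close>

lemma T3_in_J:
  assumes "f \<in> free_algebra_sharp d" "g \<in> free_algebra_sharp d" "h \<in> free_algebra_sharp d"
  shows "T3 f g h \<in> J d"
  using assms(1)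
proof (induction f rule: sharp_induct)
  case f: (single a x)
  show ?case
    using assms(2)
  proof (induction g rule: sharp_induct)
    case g: (single b y)
    show ?case
      using assms(3)
    proof (induction h rule: sharp_induct)
      case h: (single c z)
      have "linear_extension \<phi> (word u * T3 (Poly_Mapping.single (FM a) x) (Poly_Mapping.single (FM b) y) (Poly_Mapping.single (FM c) z) * word v) =
          x * y * z * (\<phi> (u @ a @ b @ c @ v) + \<phi> (u @ a @ c @ b @ v) + \<phi> (u @ b @ a @ c @ v) +
      \<phi> (u @ b @ c @ a @ v) + \<phi> (u @ c @ a @ b @ v) + \<phi> (u @ c @ b @ a @ v))" for u v
        by (simp add: word_def mult_single linear_extension_add distrib_left distrib_right plus_free_monoid_def mult_ac)
      then show ?case
        using cube_multilinear[OF f(2) g(2) h(2)]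
        by (simp add: functional_ideal_def carrier_closed single_in_carrier f g h)
    next
      case (add h h')
      then show ?case using functional_ideal_add[OF add(3,4)] by (simp add: algebra_simps)
    qed (simp add: zero_in_J)
  next
    case (add h h')
    then show ?case using functional_ideal_add[OF add(3,4)] by (simp add: algebra_simps)
  qed (simp add: zero_in_J)
next
  case (add h h')
  then show ?case using functional_ideal_add[OF add(3,4)] by (simp add: algebra_simps)
qed (simp add: zero_in_J)

lemma T2_in_J:
  assumes "f \<in> free_algebra_sharp d" "g \<in> free_algebra_sharp d"
  shows "T2 f g \<in> J d"
  using assms(1)
proof (induction f rule: sharp_induct)
  case f: (single a x)
  show ?case
    using assms(2)
  proof (induction g rule: sharp_induct)
    case g: (single b y)
    have "linear_extension \<phi> (word u * T2 (Poly_Mapping.single (FM a) x) (Poly_Mapping.single (FM b) y) * word v) =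
        x * x * y * (\<phi> (u @ a @ a @ b @ v) + \<phi> (u @ a @ b @ a @ v) + \<phi> (u @ b @ a @ a @ v))" for u v
      by (simp add: word_def mult_single linear_extension_add distrib_left distrib_right plus_free_monoid_def mult_ac)
    then show ?case
      using cube_linear[OF f(2) g(2)]
      by (simp add: functional_ideal_def carrier_closed single_in_carrier f g)
  next
    case (add h h')
    then show ?case using functional_ideal_add[OF add(3,4)] by (simp add: algebra_simps)
  qed (simp add: zero_in_J)
next
  case (add h h')
  have "T2 h g + T2 h' g + T3 h h' g \<in> J d"
    by (intro functional_ideal_add T3_in_J add assms(2))
  then show ?case by (simp add: algebra_simps)
qed (simp add: zero_in_J)

lemma cube_in_J:
  assumes "f \<in> free_algebra_sharp d"
  shows "f * f * f \<in> J d"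
  using assms
proof (induction f rule: sharp_induct)
  case f: (single a x)
  have "linear_extension \<phi> (word u * (Poly_Mapping.single (FM a) x * Poly_Mapping.single (FM a) x * Poly_Mapping.single (FM a) x) * word v) =
      x * x * x * \<phi> (u @ a @ a @ a @ v)" for u v
    by (simp add: word_def mult_single plus_free_monoid_def)
  then show ?case
    using cube[OF f(2)] by (simp add: functional_ideal_def carrier_closed single_in_carrier f)
next
  case (add f g)
  have "f * f * f + g * g * g + T2 f g + T2 g f \<in> J d"
    by (intro functional_ideal_add T2_in_J add)
  then show ?case by (simp add: algebra_simps)
qed (simp add: zero_in_J)

lemma word_not_in_nil_ideal:
  assumes "\<phi> w \<noteq> 0"
  shows "word w \<notin> (nil_ideal 3 d :: (nat free_monoid \<Rightarrow>\<^sub>0 'k) set)"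
proof
  interpret ring "free_algebra d :: (nat free_monoid \<Rightarrow>\<^sub>0 'k) ring" by (rule ring_free_algebra)
  assume "word w \<in> (nil_ideal 3 d :: (nat free_monoid \<Rightarrow>\<^sub>0 'k) set)"
  moreover have "nil_ideal 3 d \<subseteq> J d"
    unfolding nil_ideal_def
    by (rule genideal_minimal[OF ideal_functional_ideal]) (auto simp: power_free_algebra intro: cube_in_J)
  ultimately have "linear_extension \<phi> (word [] * word w * word []) = 0"
    unfolding functional_ideal_def by blast
  then have "linear_extension \<phi> (word w) = 0" by simp
  then show False using assms by (simp add: word_def)
qed

lemma nil_algebra_degree_gt_length:
  assumes "\<phi> w \<noteq> 0" "set w \<subseteq> {..<d}"
  shows "enat (Suc (length w)) \<le> nil_algebra_degree 3 d TYPE('k)"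
  by (rule nil_algebra_degree_gt[OF assms(2) word_not_in_nil_ideal[OF assms(1)]])

end

section \<open>Functionals in characteristic different from three\<close>

text \<open>
  Words with three letters \<open>x = 0\<close> and two letters \<open>y = 1\<close>. Once the value of \<open>xxyyx\<close> is \<open>1\<close>, the rest is
  forced: \<open>xxvx = - xvxx\<close> gives \<open>xyyxx\<close>, the identity for \<open>y\<close> and \<open>xx\<close> gives \<open>yxxyx\<close> and
  \<open>xyxxy\<close>, and the first rule again gives \<open>xxyxy\<close> and \<open>yxyxx\<close>.
\<close>

definition sign_form :: "nat list \<Rightarrow> int" where
  "sign_form w =
    (if w \<in> {[0,0,1,1,0], [0,1,0,0,1], [1,0,1,0,0]} then 1
     else if w \<in> {[0,0,1,0,1], [0,1,1,0,0], [1,0,0,1,0]} then -1 else 0)"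

fun splits :: "'a list \<Rightarrow> ('a list \<times> 'a list) list" where
  "splits [] = [([], [])]"
| "splits (x # w) = ([], x # w) # map (\<lambda>(u, v). (x # u, v)) (splits w)"

lemma set_splits: "set (splits w) = {(u, v). u @ v = w}"
  by (induction w) (auto simp: Cons_eq_append_conv append_eq_Cons_conv)

text \<open>
  The multilinear identity for all ways to cut a given word into \<open>u a b c v\<close>; there are finitely many words to
  test.
\<close>

definition sign_form_check :: "nat list \<Rightarrow> bool" where
  "sign_form_check w \<longleftrightarrow>
    list_all (\<lambda>(u, r). list_all (\<lambda>(a, r). a \<noteq> [] \<longrightarrow> list_all (\<lambda>(b, r). b \<noteq> [] \<longrightarrow> list_all (\<lambda>(c, v). c \<noteq> [] \<longrightarrow>
      sign_form (u @ a @ b @ c @ v) + sign_form (u @ a @ c @ b @ v) + sign_form (u @ b @ a @ c @ v) +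
      sign_form (u @ b @ c @ a @ v) + sign_form (u @ c @ a @ b @ v) + sign_form (u @ c @ b @ a @ v) = 0)
      (splits r)) (splits r)) (splits r)) (splits w)"

lemma sign_form_check_binary: "list_all sign_form_check (List.n_lists 5 [0, 1])"
  by code_simp

lemma sign_form_nonzero: "sign_form w \<noteq> 0 \<Longrightarrow> mset w = {#0, 0, 0, 1, 1#}"
  by (auto simp: sign_form_def split: if_splits)

lemma sign_form_multilinear:
  assumes "a \<noteq> []" "b \<noteq> []" "c \<noteq> []"
  shows "sign_form (u @ a @ b @ c @ v) + sign_form (u @ a @ c @ b @ v) + sign_form (u @ b @ a @ c @ v) +
      sign_form (u @ b @ c @ a @ v) + sign_form (u @ c @ a @ b @ v) + sign_form (u @ c @ b @ a @ v) = 0"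
proof (cases "mset (u @ a @ b @ c @ v) = {#0, 0, 0, 1, 1#}")
  case True
  let ?w = "u @ a @ b @ c @ v"
  have "length ?w = size {#0::nat, 0, 0, 1, 1#}" unfolding True[symmetric] by (rule size_mset[symmetric])
  moreover have "set ?w \<subseteq> {0, 1}" using arg_cong[OF True, of set_mset] by (auto simp del: mset_append)
  ultimately have "?w \<in> set (List.n_lists 5 [0, 1])" by (auto simp: set_n_lists)
  then have "sign_form_check ?w" using sign_form_check_binary by (simp add: list_all_iff)
  then show ?thesis
    unfolding sign_form_check_def list_all_iff set_splits Ball_def split_paired_All mem_Collect_eq prod.case
    by (elim allE[of _ u] allE[of _ "a @ b @ c @ v"] allE[of _ a] allE[of _ "b @ c @ v"] allE[of _ b]
        allE[of _ "c @ v"] allE[of _ c] allE[of _ v] impE) (rule refl assms | assumption)+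
next
  case False
  then have "sign_form w = 0" if "mset w = mset (u @ a @ b @ c @ v)" for w
    using sign_form_nonzero[of w] that by metis
  then show ?thesis by (simp add: add_ac)
qed

text \<open>
  Over the integers, the multilinear identity with repeated arguments is twice the linear one and six
  times the cube, so it implies both before reduction to \<open>K\<close>.
\<close>

lemma cube_functional_sign_form: "cube_functional (\<lambda>w. of_int (sign_form w) :: 'k::field)"
proof
  fix u a b c v :: "nat list"
  assume ne: "a \<noteq> []"
  have "sign_form (u @ a @ a @ a @ v) = 0"
    using sign_form_multilinear[OF ne ne ne, of u v] by linarith
  then show "of_int (sign_form (u @ a @ a @ a @ v)) = (0 :: 'k)"
    by simp
  assume nb: "b \<noteq> []"
  have "sign_form (u @ a @ a @ b @ v) + sign_form (u @ a @ b @ a @ v) + sign_form (u @ b @ a @ a @ v) = 0"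
    using sign_form_multilinear[OF ne ne nb, of u v] by linarith
  from arg_cong[OF this, of "of_int :: int \<Rightarrow> 'k"]
  show "of_int (sign_form (u @ a @ a @ b @ v)) + of_int (sign_form (u @ a @ b @ a @ v)) +
      of_int (sign_form (u @ b @ a @ a @ v)) = (0 :: 'k)" by simp
  assume nc: "c \<noteq> []"
  from arg_cong[OF sign_form_multilinear[OF ne nb nc, of u v], of "of_int :: int \<Rightarrow> 'k"]
  show "of_int (sign_form (u @ a @ b @ c @ v)) + of_int (sign_form (u @ a @ c @ b @ v)) +
      of_int (sign_form (u @ b @ a @ c @ v)) + of_int (sign_form (u @ b @ c @ a @ v)) +
      of_int (sign_form (u @ c @ a @ b @ v)) + of_int (sign_form (u @ c @ b @ a @ v)) = (0 :: 'k)"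
    by simp
qed

lemma nil_algebra_degree_ge_6:
  assumes "d > 1"
  shows "6 \<le> nil_algebra_degree 3 d TYPE('k::field)"
proof -
  interpret cube_functional "\<lambda>w. of_int (sign_form w) :: 'k" by (rule cube_functional_sign_form)
  have "enat (Suc (length [0::nat, 0, 1, 1, 0])) \<le> nil_algebra_degree 3 d TYPE('k)"
    by (rule nil_algebra_degree_gt_length) (use assms in \<open>auto simp: sign_form_def\<close>)
  then show ?thesis by (simp add: numeral_eq_enat eval_nat_numeral)
qed

text \<open>
  The pair of adjacent zeros that appears when two words are joined.
\<close>

definition seam :: "nat list \<Rightarrow> nat list \<Rightarrow> nat" where
  "seam u v = of_bool (u \<noteq> [] \<and> v \<noteq> [] \<and> last u = 0 \<and> hd v = 0)"

fun zero_pairs :: "nat list \<Rightarrow> nat" where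
  "zero_pairs [] = 0"
| "zero_pairs (x # w) = seam [x] w + zero_pairs w"

lemma zero_pairs_append: "zero_pairs (u @ v) = zero_pairs u + seam u v + zero_pairs v"
  by (induction u) (auto simp: seam_def)

lemma seam_append_right: "a \<noteq> [] \<Longrightarrow> seam u (a @ v) = seam u a"
  by (simp add: seam_def)

lemma zero_pairs_eq_0: "count_list w 0 \<le> 1 \<Longrightarrow> zero_pairs w = 0"
proof (induction w)
  case (Cons x w)
  then show ?case by (cases w) (auto simp: seam_def count_list_0_iff split: if_splits)
qed simp

definition pair_form :: "nat list \<Rightarrow> 'k::field" where
  "pair_form w = (if count_list w 0 = 3 \<and> (\<forall>y>0. count_list w y \<le> 1) then of_nat (zero_pairs w) else 0)"

text \<open>
  In the six orders of \<open>a, b, c\<close>, the pairs inside a factor are counted six times and each seam between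
  two factors, or with \<open>u\<close> or \<open>v\<close>, twice: the sum is even. The identities with a repeated factor only
  concern the repeated factor \<open>[0]\<close>, since all other letters occur at most once.
\<close>

lemma cube_functional_pair_form:
  assumes two: "(2::'k::field) = 0"
  shows "cube_functional (pair_form :: nat list \<Rightarrow> 'k)"
proof -
  let ?P = "\<lambda>w::nat list. count_list w 0 = 3 \<and> (\<forall>y>0. count_list w y \<le> 1)"
  have even_zero: "of_nat n = (0::'k)" if "even n" for n
    using that two by (auto elim!: evenE)
  have repeated: "a = [0] \<and> count_list (u @ b @ v) 0 = 1"
    if "?P (u @ a @ a @ b @ v)" "a \<noteq> []" for u a b v
  proof -
    have z: "y = 0" if "y \<in> set a" for y
    proof (rule ccontr)
      assume "y \<noteq> 0"
      then have "count_list (u @ a @ a @ b @ v) y \<le> 1" using \<open>?P (u @ a @ a @ b @ v)\<close> by simp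
      then show False using that count_list_0_iff[of a y] by simp
    qed
    then have "a = replicate (length a) 0" by (simp add: replicate_length_same)
    then have "count_list a 0 = length a" using z by (simp add: count_list_eq_length_filter filter_id_conv)
    moreover have "count_list a 0 + count_list a 0 + count_list (u @ b @ v) 0 = 3" using that(1) by simp
    ultimately have "length a = 1" "count_list (u @ b @ v) 0 = 1"
      using that(2) by (cases a; cases "tl a"; simp)+
    then show ?thesis using \<open>a = replicate (length a) 0\<close> by simp
  qed
  show ?thesis
  proof
    fix u a v :: "nat list" assume "a \<noteq> []"
    show "pair_form (u @ a @ a @ a @ v) = (0::'k)"
    proof (cases "?P (u @ a @ a @ a @ v)")
      case True
      then have a: "a = [0]" and "count_list (u @ a @ v) 0 = 1" using repeated[OF True] \<open>a \<noteq> []\<close> by blast+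
      then have "0 \<notin> set u" "0 \<notin> set v" by (simp_all add: count_list_0_iff)
      then have "u = [] \<or> last u \<noteq> 0" "v = [] \<or> hd v \<noteq> 0"
        using last_in_set[of u] hd_in_set[of v] by metis+
      moreover have "zero_pairs u = 0" "zero_pairs v = 0"
        using \<open>0 \<notin> set u\<close> \<open>0 \<notin> set v\<close> by (simp_all add: zero_pairs_eq_0 count_list_0_iff)
      ultimately have "zero_pairs (u @ a @ a @ a @ v) = 2"
        using a by (auto simp: zero_pairs_append seam_def)
      then show ?thesis by (simp add: pair_form_def two)
    qed (auto simp: pair_form_def)
  next
    fix u a b v :: "nat list" assume ne: "a \<noteq> []" "b \<noteq> []"
    \<comment> \<open>The condition on letter counts is the same for all terms of the identity.\<close>
    define good where "good \<longleftrightarrow> ?P (u @ a @ a @ b @ v)"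
    have same: "pair_form w = of_bool good * (of_nat (zero_pairs w) :: 'k)"
      if "mset w = mset (u @ a @ a @ b @ v)" for w
    proof -
      have "count_list w y = count_list (u @ a @ a @ b @ v) y" for y using that by (metis count_mset)
      then show ?thesis by (simp only: pair_form_def good_def) simp
    qed
    have even: "even (zero_pairs (u @ a @ a @ b @ v) + zero_pairs (u @ a @ b @ a @ v) + zero_pairs (u @ b @ a @ a @ v))"
      if good
    proof -
      have a: "a = [0]" and one: "count_list (u @ b @ v) 0 = 1" using repeated[OF that[unfolded good_def] ne(1)] by blast+
      \<comment> \<open>A single zero is left for \<open>u\<close>, \<open>b\<close>, \<open>v\<close> together, so they contain no pair.\<close>
      have "zero_pairs u = 0" "zero_pairs (b @ v) = 0" "zero_pairs (u @ b) = 0"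
        using one by (simp_all add: zero_pairs_eq_0)
      then have z: "zero_pairs u = 0" "zero_pairs b = 0" "zero_pairs v = 0" "seam b v = 0" "seam u b = 0"
        by (simp_all add: zero_pairs_append)
      have "zero_pairs (u @ a @ a @ b @ v) = seam u [0] + 1 + seam [0] b"
        using z ne by (simp add: zero_pairs_append seam_append_right a) (simp add: seam_def)
      moreover have "zero_pairs (u @ a @ b @ a @ v) = seam u [0] + seam [0] b + seam b [0] + seam [0] v"
        using z ne by (simp add: zero_pairs_append seam_append_right a) (simp add: seam_def)
      moreover have "zero_pairs (u @ b @ a @ a @ v) = seam b [0] + 1 + seam [0] v"
        using z ne by (simp add: zero_pairs_append seam_append_right a) (simp add: seam_def)
      ultimately show ?thesis by presburger
    qed
    let ?z = "of_bool good :: 'k"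
    have "?z * of_nat (zero_pairs (u @ a @ a @ b @ v)) +
        ?z * of_nat (zero_pairs (u @ a @ b @ a @ v)) +
        ?z * of_nat (zero_pairs (u @ b @ a @ a @ v)) = 0"
      unfolding distrib_left[symmetric] of_nat_add[symmetric]
      by (cases good) (simp_all only: of_bool_eq even_zero[OF even] mult_zero_left mult_zero_right)
    then show "pair_form (u @ a @ a @ b @ v) + pair_form (u @ a @ b @ a @ v) + pair_form (u @ b @ a @ a @ v) = (0::'k)"
      by (simp only: same mset_append union_ac)
  next
    fix u a b c v :: "nat list" assume ne: "a \<noteq> []" "b \<noteq> []" "c \<noteq> []"
    \<comment> \<open>As above, one condition on letter counts for all six terms.\<close>
    define good where "good \<longleftrightarrow> ?P (u @ a @ b @ c @ v)"
    have same: "pair_form w = of_bool good * (of_nat (zero_pairs w) :: 'k)"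
      if "mset w = mset (u @ a @ b @ c @ v)" for w
    proof -
      have "count_list w y = count_list (u @ a @ b @ c @ v) y" for y using that by (metis count_mset)
      then show ?thesis by (simp only: pair_form_def good_def) simp
    qed
    let ?inside = "zero_pairs u + zero_pairs a + zero_pairs b + zero_pairs c + zero_pairs v"
      and ?seams = "seam u a + seam u b + seam u c + seam a v + seam b v + seam c v +
        seam a b + seam b a + seam a c + seam c a + seam b c + seam c b"
    have "zero_pairs (u @ a @ b @ c @ v) +
        zero_pairs (u @ a @ c @ b @ v) +
        zero_pairs (u @ b @ a @ c @ v) +
        zero_pairs (u @ b @ c @ a @ v) +
        zero_pairs (u @ c @ a @ b @ v) +
        zero_pairs (u @ c @ b @ a @ v) =
        2 * (3 * ?inside + ?seams)"
      by (simp add: zero_pairs_append seam_append_right ne)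
    then have even: "even (zero_pairs (u @ a @ b @ c @ v) +
        zero_pairs (u @ a @ c @ b @ v) +
        zero_pairs (u @ b @ a @ c @ v) +
        zero_pairs (u @ b @ c @ a @ v) +
        zero_pairs (u @ c @ a @ b @ v) +
        zero_pairs (u @ c @ b @ a @ v))"
      by simp
    let ?z = "of_bool good :: 'k"
    have "?z * of_nat (zero_pairs (u @ a @ b @ c @ v)) +
        ?z * of_nat (zero_pairs (u @ a @ c @ b @ v)) +
        ?z * of_nat (zero_pairs (u @ b @ a @ c @ v)) +
        ?z * of_nat (zero_pairs (u @ b @ c @ a @ v)) +
        ?z * of_nat (zero_pairs (u @ c @ a @ b @ v)) +
        ?z * of_nat (zero_pairs (u @ c @ b @ a @ v)) = 0"
      unfolding distrib_left[symmetric] of_nat_add[symmetric]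
      by (cases good) (simp_all only: of_bool_eq even_zero[OF even] mult_zero_left mult_zero_right)
    then show "pair_form (u @ a @ b @ c @ v) + pair_form (u @ a @ c @ b @ v) + pair_form (u @ b @ a @ c @ v) +
        pair_form (u @ b @ c @ a @ v) + pair_form (u @ c @ a @ b @ v) + pair_form (u @ c @ b @ a @ v) = (0::'k)"
      by (simp only: same mset_append union_ac)
  qed
qed

lemma nil_algebra_degree_char_2_ge:
  assumes "(2::'k::field) = 0" "d \<ge> 2"
  shows "enat (d + 3) \<le> nil_algebra_degree 3 d TYPE('k)"
proof -
  interpret cube_functional "pair_form :: nat list \<Rightarrow> 'k" by (rule cube_functional_pair_form[OF assms(1)])
  let ?w = "[0, 0, 1, 0] @ [2..<d]"
  have z: "zero_pairs [2..<d] = 0" by (rule zero_pairs_eq_0) (simp add: count_list_0_iff)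
  have "zero_pairs ?w = 1" unfolding zero_pairs_append z
    by (cases "d = 2") (use assms(2) in \<open>simp_all add: seam_def\<close>)
  moreover have "count_list [2..<d] y \<le> 1" for y
    using distinct_count_atmost_1[of "[2..<d]"] count_mset[of "[2..<d]" y] by (simp add: count_mset[symmetric])
  moreover have "count_list [2..<d] 0 = 0" "count_list [2..<d] 1 = 0" by (simp_all add: count_list_0_iff)
  ultimately have "pair_form ?w = (1::'k)" by (auto simp: pair_form_def)
  then have "enat (Suc (length ?w)) \<le> nil_algebra_degree 3 d TYPE('k)"
    by (intro nil_algebra_degree_gt_length) (use assms(2) in auto)
  moreover have "Suc (length ?w) = d + 3" using assms(2) by simp
  ultimately show ?thesis by (simp only:)
qed

section \<open>The Grassmann model in characteristic three\<close>

text \<open>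
  Reordering each of the six products to \<open>abc\<close> costs commutators. If these are central, all terms
  collect with coefficients divisible by three.
\<close>

lemma identities_of_central_commutators:
  fixes a b c :: "'r::ring_1"
  assumes three: "\<And>x::'r. x + x + x = 0"
    and ab: "(a * b - b * a) * c = c * (a * b - b * a)"
    and ac: "(a * c - c * a) * b = b * (a * c - c * a)"
  shows "a * b * c + a * c * b + b * a * c + b * c * a + c * a * b + c * b * a = 0"
proof -
  let ?x = "a * b * c + a * b * c - a * (b * c - c * b) - (a * b - b * a) * c - (a * c - c * a) * b"
  have "a * b * c + a * c * b + b * a * c + b * c * a + c * a * b + c * b * a =
      (?x + ?x + ?x) + ((a * b - b * a) * c - c * (a * b - b * a)) + ((a * c - c * a) * b - b * (a * c - c * a))"
    by (simp add: algebra_simps)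
  also have "\<dots> = 0" by (simp only: three ab ac diff_self add_0)
  finally show ?thesis .
qed

lemma linear_identity_of_central_commutators:
  fixes a b :: "'r::ring_1"
  assumes three: "\<And>x::'r. x + x + x = 0"
    and ab: "(a * b - b * a) * a = a * (a * b - b * a)"
  shows "a * a * b + a * b * a + b * a * a = 0"
proof -
  let ?x = "a * a * b - a * (a * b - b * a)"
  have "a * a * b + a * b * a + b * a * a =
      (?x + ?x + ?x) + (a * (a * b - b * a) - (a * b - b * a) * a)"
    by (simp add: algebra_simps)
  also have "\<dots> = 0" by (simp only: three ab diff_self add_0)
  finally show ?thesis .
qed

text \<open>
  The relations of the generators of \<open>K[t\<^sub>1, t\<^sub>2, \<dots>]/(t\<^sub>i\<^sup>3) \<otimes> \<Lambda>(e\<^sub>1, e\<^sub>2, \<dots>)\<close> in characteristic three.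
\<close>

locale grassmann_letters =
  fixes t e :: "nat \<Rightarrow> 'r::ring_1"
  assumes three: "(x::'r) + x + x = 0"
    and tt: "t i * t j = t j * t i"
    and et: "e i * t j = t j * e i"
    and ee: "e i * e j = - (e j * e i)"
    and t_cube: "t i * t i * t i = 0"
begin

lemma square_eq_0: "(x::'r) * x = - (x * x) \<Longrightarrow> x * x = 0"
  using three[of "x * x"] by (simp add: eq_neg_iff_add_eq_0)

lemma e_square: "e i * e i = 0"
  by (rule square_eq_0[OF ee])

definition letter :: "nat \<Rightarrow> 'r" where
  "letter i = t i + e i"

definition eval_word :: "nat list \<Rightarrow> 'r" where
  "eval_word w = prod_list (map letter w)"

lemma eval_word_append: "eval_word (u @ v) = eval_word u * eval_word v"
  by (simp add: eval_word_def)

text \<open>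
  The even and the odd part of the value of a word, with respect to the degree in the \<open>e\<^sub>i\<close>.
\<close>

fun parts :: "nat list \<Rightarrow> 'r \<times> 'r" where
  "parts [] = (1, 0)"
| "parts (i # w) = (case parts w of (p, q) \<Rightarrow> (t i * p + e i * q, t i * q + e i * p))"

lemma eval_word_parts: "eval_word w = fst (parts w) + snd (parts w)"
  by (induction w) (auto simp: eval_word_def letter_def algebra_simps split: prod.splits)

lemma commute_parts:
  assumes "\<And>i. r * t i = t i * r" "\<And>i. r * e i = e i * r"
  shows "r * fst (parts w) = fst (parts w) * r \<and> r * snd (parts w) = snd (parts w) * r"
proof (induction w)
  case (Cons i w)
  have "r * (t i * x) = t i * (r * x)" "r * (e i * x) = e i * (r * x)" for x
    using assms by (metis mult.assoc)+
  then show ?case using Cons by (auto simp: distrib_left distrib_right mult.assoc split: prod.splits)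
qed simp

lemma anticommute_parts:
  assumes "\<And>i. r * t i = t i * r" "\<And>i. r * e i = - (e i * r)"
  shows "r * fst (parts w) = fst (parts w) * r \<and> r * snd (parts w) = - (snd (parts w) * r)"
proof (induction w)
  case (Cons i w)
  have "r * (t i * x) = t i * (r * x)" "r * (e i * x) = - (e i * (r * x))" for x
    using assms by (metis mult.assoc mult_minus_left)+
  then show ?case using Cons by (auto simp: distrib_left distrib_right mult.assoc split: prod.splits)
qed simp

lemma letters_parts:
  "t i * fst (parts w) = fst (parts w) * t i \<and> t i * snd (parts w) = snd (parts w) * t i"
  "e i * fst (parts w) = fst (parts w) * e i \<and> e i * snd (parts w) = - (snd (parts w) * e i)"
  by (rule commute_parts anticommute_parts; simp add: tt et ee[of i])+

lemma even_commutes: "fst (parts u) * fst (parts w) = fst (parts w) * fst (parts u)"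
    "fst (parts u) * snd (parts w) = snd (parts w) * fst (parts u)"
  using commute_parts[of "fst (parts u)" w] letters_parts[of _ u] by metis+

lemma odd_anticommutes: "snd (parts u) * snd (parts w) = - (snd (parts w) * snd (parts u))"
proof -
  have "snd (parts u) * t i = t i * snd (parts u)" "snd (parts u) * e i = - (e i * snd (parts u))" for i
    using letters_parts(1)[of i u] letters_parts(2)[of i u] by simp_all
  then show ?thesis using anticommute_parts[of "snd (parts u)" w] by blast
qed

lemma odd_square: "snd (parts w) * snd (parts w) = 0"
  by (rule square_eq_0[OF odd_anticommutes])

lemma binomial_cube:
  fixes x y :: 'r
  assumes "x * y = y * x"
  shows "(x + y) * (x + y) * (x + y) = x * x * x + y * y * y"
proof -
  have "x * (y * z) = y * (x * z)" for z using assms by (metis mult.assoc)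
  then have "(x + y) * (x + y) * (x + y) =
      x * x * x + (y * x * x + y * x * x + y * x * x) + (y * y * x + y * y * x + y * y * x) + y * y * y"
    using assms by (simp add: algebra_simps)
  then show ?thesis using three by simp
qed

text \<open>
  The even part of \<open>x\<^sub>i v\<close> is \<open>t\<^sub>i p + e\<^sub>i q\<close>, where \<open>p\<close>, \<open>q\<close> are the parts of \<open>v\<close>. The two summands
  commute, so in characteristic three the cube is the sum of their cubes, and these vanish by
  \<open>t\<^sub>i\<^sup>3 = 0\<close> and \<open>e\<^sub>i\<^sup>2 = 0\<close>.
\<close>

lemma even_cube: "w \<noteq> [] \<Longrightarrow> fst (parts w) * fst (parts w) * fst (parts w) = 0"
proof (cases w)
  case (Cons i v)
  let ?p = "fst (parts v)" and ?q = "snd (parts v)"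
  have p: "?p * t i = t i * ?p" "?p * (t i * x) = t i * (?p * x)" for x
    using letters_parts(1)[of i v] by (simp_all add: mult.assoc[symmetric])
  have qe: "?q * e i = - (e i * ?q)" using letters_parts(2)[of i v] by simp
  have "t i * (t i * (t i * x)) = 0" for x using t_cube[of i] by (metis mult.assoc mult_zero_left)
  then have 1: "t i * ?p * (t i * ?p) * (t i * ?p) = 0" by (simp add: mult.assoc p)
  have "e i * ?q * (e i * ?q) = e i * (?q * e i) * ?q" by (simp add: mult.assoc)
  also have "\<dots> = - (e i * e i * (?q * ?q))" by (simp add: qe mult.assoc)
  finally have 2: "e i * ?q * (e i * ?q) = 0" by (simp add: e_square)
  have q: "?q * t i = t i * ?q" using letters_parts(1)[of i v] by simp
  have "t i * ?p * (e i * ?q) = t i * (?p * e i) * ?q" by (simp add: mult.assoc)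
  also have "\<dots> = t i * e i * (?p * ?q)"
    by (simp add: letters_parts(2)[of i v, THEN conjunct1, symmetric] mult.assoc)
  also have "\<dots> = e i * (t i * ?q) * ?p" by (simp add: et[of i i, symmetric] even_commutes(2) mult.assoc)
  also have "\<dots> = e i * ?q * (t i * ?p)" by (simp add: q[symmetric] mult.assoc)
  finally have "(t i * ?p + e i * ?q) * (t i * ?p + e i * ?q) * (t i * ?p + e i * ?q) = 0"
    by (simp add: binomial_cube 1 2)
  moreover have "fst (parts w) = t i * ?p + e i * ?q" using Cons by (cases "parts v") simp
  ultimately show ?thesis by simp
qed simp

lemma eval_word_cube:
  assumes "w \<noteq> []"
  shows "eval_word w * eval_word w * eval_word w = 0"
  unfolding eval_word_parts binomial_cube[OF even_commutes(2)]
  by (simp add: even_cube[OF assms] odd_square)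

text \<open>
  Only the odd parts contribute to a commutator, and a product of two odd elements is even, hence central.
\<close>

lemma commutator_central:
  "(eval_word u * eval_word v - eval_word v * eval_word u) * eval_word w =
    eval_word w * (eval_word u * eval_word v - eval_word v * eval_word u)"
proof -
  let ?p = "\<lambda>w. fst (parts w)" and ?q = "\<lambda>w. snd (parts w)"
  have "eval_word u * eval_word v - eval_word v * eval_word u = ?q u * ?q v + ?q u * ?q v"
  proof -
    have "eval_word u * eval_word v - eval_word v * eval_word u =
        (?p u * ?p v - ?p v * ?p u) + (?p u * ?q v - ?q v * ?p u) + (?q u * ?p v - ?p v * ?q u)
        + (?q u * ?q v - ?q v * ?q u)"
      unfolding eval_word_parts by (simp add: algebra_simps)
    then show ?thesis
      using even_commutes[of u v] even_commutes(2)[of v u] odd_anticommutes[of v u] by simp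
  qed
  moreover have "?q u * ?q v * eval_word w = eval_word w * (?q u * ?q v)"
  proof -
    have "?q u * ?q v * ?q w = ?q u * (?q v * ?q w)" by (simp add: mult.assoc)
    also have "\<dots> = - (?q u * ?q w * ?q v)" by (simp add: odd_anticommutes[of v w] mult.assoc)
    also have "\<dots> = ?q w * (?q u * ?q v)" by (simp add: odd_anticommutes[of u w] mult.assoc)
    finally have "?q u * ?q v * ?q w = ?q w * (?q u * ?q v)" .
    moreover have "?q u * ?q v * ?p w = ?p w * (?q u * ?q v)"
      by (metis even_commutes(2) mult.assoc)
    ultimately show ?thesis by (simp add: eval_word_parts distrib_left distrib_right)
  qed
  ultimately show ?thesis by (simp add: distrib_left distrib_right)
qed

lemma cube_functional_eval_word:
  fixes l :: "'r \<Rightarrow> 'k::field"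
  assumes add: "\<And>x y. l (x + y) = l x + l y"
  shows "cube_functional (\<lambda>w. l (eval_word w))"
proof -
  have zero: "l 0 = 0" using add[of 0 0] by (metis add_0_left add_cancel_right_left)
  show ?thesis
  proof
    fix u a v :: "nat list" assume "a \<noteq> []"
    then have "eval_word (u @ a @ a @ a @ v) = 0"
      using eval_word_cube[of a]
      by (metis eval_word_append append.assoc mult_zero_left mult_zero_right)
    then show "l (eval_word (u @ a @ a @ a @ v)) = 0" by (simp add: zero)
  next
    fix u a b v :: "nat list"
    let ?x = "eval_word a" and ?y = "eval_word b"
    have "eval_word (u @ a @ a @ b @ v) + eval_word (u @ a @ b @ a @ v) + eval_word (u @ b @ a @ a @ v) =
        eval_word u * (?x * ?x * ?y + ?x * ?y * ?x + ?y * ?x * ?x) * eval_word v"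
      by (simp add: eval_word_append algebra_simps)
    also have "\<dots> = 0" by (simp add: linear_identity_of_central_commutators[OF three commutator_central])
    finally show "l (eval_word (u @ a @ a @ b @ v)) + l (eval_word (u @ a @ b @ a @ v)) +
        l (eval_word (u @ b @ a @ a @ v)) = 0"
      by (simp add: add[symmetric] zero)
  next
    fix u a b c v :: "nat list"
    let ?x = "eval_word a" and ?y = "eval_word b" and ?z = "eval_word c"
    have "eval_word (u @ a @ b @ c @ v) + eval_word (u @ a @ c @ b @ v) + eval_word (u @ b @ a @ c @ v) +
        eval_word (u @ b @ c @ a @ v) + eval_word (u @ c @ a @ b @ v) + eval_word (u @ c @ b @ a @ v) =
        eval_word u * (?x * ?y * ?z + ?x * ?z * ?y + ?y * ?x * ?z + ?y * ?z * ?x + ?z * ?x * ?y + ?z * ?y * ?x) * eval_word v"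
      by (simp add: eval_word_append algebra_simps)
    also have "\<dots> = 0"
      by (simp add: identities_of_central_commutators[OF three commutator_central commutator_central])
    finally show "l (eval_word (u @ a @ b @ c @ v)) + l (eval_word (u @ a @ c @ b @ v)) +
        l (eval_word (u @ b @ a @ c @ v)) + l (eval_word (u @ b @ c @ a @ v)) +
        l (eval_word (u @ c @ a @ b @ v)) + l (eval_word (u @ c @ b @ a @ v)) = 0"
      by (simp add: add[symmetric] zero)
  qed
qed

lemma eval_word_square: "eval_word [i, i] = t i * t i + t i * e i + t i * e i"
  by (simp add: eval_word_def letter_def algebra_simps e_square et)

text \<open>
  Exactly one \<open>x\<close> and one \<open>y\<close> have to contribute their odd summand, as \<open>t\<^sup>3 = 0\<close> and \<open>e\<^sup>2 = 0\<close>. In \<open>xxyyxy\<close> the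
  chosen \<open>x\<close> precedes the chosen \<open>y\<close> in seven of nine cases, so the coefficient is \<open>7 - 2 = 5 = - 1\<close>.
\<close>

lemma eval_word_block:
  "eval_word [i, i, j, j, i, j] = - (t i * t i * t j * t j * e i * e j)"
proof -
  have com: "t j * t i = t i * t j" "t j * (t i * x) = t i * (t j * x)"
    "e k * t l = t l * e k" "e k * (t l * x) = t l * (e k * x)"
    "e j * e i = - (e i * e j)" "e j * (e i * x) = - (e i * (e j * x))" for k l x
    by (metis tt et ee mult.assoc mult_minus_left)+
  have nil: "e k * e k = 0" "e k * (e k * x) = 0" "t k * (t k * t k) = 0" "t k * (t k * (t k * x)) = 0" for k x
    by (metis e_square t_cube mult.assoc mult_zero_left)+
  let ?m = "t i * t i * t j * t j * e i * e j"
  have "eval_word [i, i, j, j, i, j] = eval_word [i, i] * eval_word [j, j] * (letter i * letter j)"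
    by (simp add: eval_word_def mult.assoc)
  also have "\<dots> = (?m + ?m + ?m) + (?m + ?m + ?m) - ?m"
    unfolding eval_word_square letter_def
    by (simp add: distrib_left distrib_right mult.assoc com nil)
  finally show ?thesis by (simp add: three)
qed

end

text \<open>
  A concrete model: the basis of \<open>K[t\<^sub>1, t\<^sub>2, \<dots>]/(t\<^sub>i\<^sup>3) \<otimes> \<Lambda>(e\<^sub>1, e\<^sub>2, \<dots>)\<close> is indexed by a set of indices of
  the \<open>e\<^sub>i\<close> and an exponent vector for the \<open>t\<^sub>i\<close>. The algebra is represented by its left multiplications on
  coefficient functions; these are additive maps, and such maps form a ring.
\<close>

type_synonym state = "nat set \<times> (nat \<Rightarrow> nat)"

typedef (overloaded) 'k operator =
  "{F :: (state \<Rightarrow> 'k::field) \<Rightarrow> state \<Rightarrow> 'k. \<forall>a b. F (\<lambda>s. a s + b s) = (\<lambda>s. F a s + F b s)}"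
  by (rule exI[of _ "\<lambda>a. a"]) simp

setup_lifting type_definition_operator

instantiation operator :: (field) ring_1
begin

lift_definition zero_operator :: "'a operator" is "\<lambda>_ _. 0" by simp

lift_definition one_operator :: "'a operator" is "\<lambda>a. a" by simp

lift_definition plus_operator :: "'a operator \<Rightarrow> 'a operator \<Rightarrow> 'a operator"
  is "\<lambda>F G a s. F a s + G a s" by (simp add: fun_eq_iff)

lift_definition minus_operator :: "'a operator \<Rightarrow> 'a operator \<Rightarrow> 'a operator"
  is "\<lambda>F G a s. F a s - G a s" by (simp add: fun_eq_iff)

lift_definition uminus_operator :: "'a operator \<Rightarrow> 'a operator"
  is "\<lambda>F a s. - F a s" by (simp add: fun_eq_iff)

lift_definition times_operator :: "'a operator \<Rightarrow> 'a operator \<Rightarrow> 'a operator"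
  is "\<lambda>F G a. F (G a)" by simp

instance
proof
  show "(0 :: 'a operator) \<noteq> 1"
    by transfer (metis one_neq_zero)
qed (transfer; simp add: fun_eq_iff algebra_simps)+

end

lift_definition apply_op :: "'k::field operator \<Rightarrow> (state \<Rightarrow> 'k) \<Rightarrow> state \<Rightarrow> 'k" is "\<lambda>F. F" .

lemma operator_eqI: "(\<And>a s. apply_op F a s = apply_op G a s) \<Longrightarrow> F = G"
  by transfer (simp add: fun_eq_iff)

lemma apply_op_simps [simp]:
  "apply_op (F + G) a s = apply_op F a s + apply_op G a s"
  "apply_op (- F) a s = - apply_op F a s"
  "apply_op (F * G) a s = apply_op F (apply_op G a) s"
  "apply_op 0 a s = 0"
  "apply_op 1 a s = a s"
  by (transfer; simp)+

text \<open>
  Multiplication by \<open>t\<^sub>i\<close>; coefficients at exponents above \<open>2\<close> are cut off because \<open>t\<^sub>i\<^sup>3 = 0\<close>.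
\<close>

lift_definition raise :: "nat \<Rightarrow> 'k::field operator"
  is "\<lambda>i a (S, \<alpha>). if \<alpha> i = 1 \<or> \<alpha> i = 2 then a (S, \<alpha>(i := \<alpha> i - 1)) else 0"
  by (auto simp: fun_eq_iff)

text \<open>
  Left multiplication by \<open>e\<^sub>i\<close>; the sign moves \<open>e\<^sub>i\<close> past the smaller indices into increasing order.
\<close>

lift_definition wedge :: "nat \<Rightarrow> 'k::field operator"
  is "\<lambda>i a (S, \<alpha>). if i \<in> S then (-1) ^ card {j \<in> S. j < i} * a (S - {i}, \<alpha>) else 0"
  by (auto simp: fun_eq_iff algebra_simps)

lemma apply_raise:
  "apply_op (raise i) a (S, \<alpha>) = (if \<alpha> i = 1 \<or> \<alpha> i = 2 then a (S, \<alpha>(i := \<alpha> i - 1)) else 0)"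
  by transfer simp

lemma apply_wedge:
  "apply_op (wedge i) a (S, \<alpha>) = (if i \<in> S then (-1) ^ card {j \<in> S. j < i} * a (S - {i}, \<alpha>) else 0)"
  by transfer simp

lemma wedge_anticommute: "wedge i * wedge j = - (wedge j * wedge i :: 'k::field operator)"
proof (rule operator_eqI)
  fix a :: "state \<Rightarrow> 'k" and s :: state
  obtain S \<alpha> where s: "s = (S, \<alpha>)" by (cases s)
  have swap: "apply_op (wedge i * wedge j) a (S, \<alpha>) = - apply_op (wedge j * wedge i) a (S, \<alpha>)"
    if "i < j" for i j
  proof (cases "i \<in> S \<and> j \<in> S")
    case True
    have 1: "{k \<in> S. k \<noteq> j \<and> k < i} = {k \<in> S. k < i}" using that by auto
    have 2: "{k \<in> S. k < j} = insert i {k \<in> S - {i}. k < j}" using that True by auto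
    have 3: "S - {i} - {j} = S - {j} - {i}" by auto
    have "card {k \<in> S. k < j} = Suc (card {k \<in> S - {i}. k < j})"
      unfolding 2 by (subst card_insert_disjoint) auto
    then show ?thesis using True that by (simp add: apply_wedge 1 3)
  qed (auto simp: apply_wedge)
  show "apply_op (wedge i * wedge j) a s = apply_op (- (wedge j * wedge i)) a s"
  proof (cases i j rule: linorder_cases)
    case less
    then show ?thesis using swap[of i j] s by simp
  next
    case equal
    then show ?thesis by (simp add: s apply_wedge)
  next
    case greater
    then show ?thesis using swap[of j i] s by simp
  qed
qed

lemma grassmann_letters_operator:
  assumes "(3::'k::field) = 0"
  shows "grassmann_letters (raise :: nat \<Rightarrow> 'k operator) wedge"
proof
  have "x + x + x = 3 * x" for x :: 'k by simp
  then have three: "x + x + x = 0" for x :: 'k using assms by simp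
  show "F + F + F = 0" for F :: "'k operator"
    by (rule operator_eqI) (simp only: apply_op_simps three)
  show "raise i * raise j = raise j * (raise i :: 'k operator)" for i j
    by (rule operator_eqI) (auto simp: apply_raise fun_upd_twist split: prod.splits)
  show "wedge i * raise j = raise j * (wedge i :: 'k operator)" for i j
    by (rule operator_eqI) (auto simp: apply_raise apply_wedge)
  show "wedge i * wedge j = - (wedge j * (wedge i :: 'k operator))" for i j
    by (rule wedge_anticommute)
  show "raise i * raise i * raise i = (0 :: 'k operator)" for i
    by (rule operator_eqI) (auto simp: apply_raise)
qed

text \<open>
  Each block contributes the top monomial in its pair of letters; the blocks run downwards, so that the outermost
  operators strip the largest indices from the top state.
\<close>

primrec block_word :: "nat \<Rightarrow> nat list" where
  "block_word 0 = []"
| "block_word (Suc m) =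
    [2 * m, 2 * m, Suc (2 * m), Suc (2 * m), 2 * m, Suc (2 * m)] @ block_word m"

lemma set_block_word: "set (block_word m) \<subseteq> {..<2 * m}"
  by (induction m) auto

lemma length_block_word: "length (block_word m) = 6 * m"
  by (induction m) auto

definition vacuum :: "state \<Rightarrow> 'k::field" where
  "vacuum s = of_bool (s = ({}, \<lambda>_. 0))"

definition top_state :: "nat \<Rightarrow> nat \<Rightarrow> state" where
  "top_state m k = ({..<m}, \<lambda>i. if i < k then 2 else 0)"

lemma block_word_top:
  assumes "(3::'k::field) = 0"
  shows "apply_op (grassmann_letters.eval_word raise wedge (block_word m)) vacuum (top_state (2 * m) (2 * m)) \<noteq> (0::'k)"
proof (induction m)
  interpret grassmann_letters "raise :: nat \<Rightarrow> 'k operator" wedge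
    by (rule grassmann_letters_operator[OF assms])
  case 0
  show ?case by (simp add: eval_word_def vacuum_def top_state_def)
  case (Suc m)
  let ?\<alpha> = "\<lambda>i. if i < 2 * m then 2 else (0::nat)"
  let ?\<beta> = "\<lambda>i. if i < Suc (Suc (2 * m)) then 2 else (0::nat)"
  have "{..<Suc (Suc (2 * m))} - {2 * m} - {Suc (2 * m)} = {..<2 * m}" by auto
  moreover have "?\<beta>(2 * m := 0, Suc (2 * m) := 0) = ?\<alpha>" by auto
  ultimately show ?case
    using Suc unfolding block_word.simps eval_word_append eval_word_block
    by (simp add: top_state_def apply_raise apply_wedge)
qed

text \<open>
  For an odd number of letters the last one contributes only its \<open>t\<^sup>2\<close>, which brings the length to
  \<open>3 d - 1\<close>.
\<close>

lemma block_word_square_top: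
  assumes "(3::'k::field) = 0"
  shows "apply_op (grassmann_letters.eval_word raise wedge ([2 * m, 2 * m] @ block_word m)) vacuum
    (top_state (2 * m) (Suc (2 * m))) \<noteq> (0::'k)"
proof -
  interpret grassmann_letters "raise :: nat \<Rightarrow> 'k operator" wedge
    by (rule grassmann_letters_operator[OF assms])
  let ?\<alpha> = "\<lambda>i. if i < 2 * m then 2 else (0::nat)"
  let ?\<beta> = "\<lambda>i. if i < Suc (2 * m) then 2 else (0::nat)"
  have "?\<beta>(2 * m := 0) = ?\<alpha>" by auto
  then show ?thesis
    using block_word_top[OF assms, of m] unfolding eval_word_append eval_word_square
    by (simp add: top_state_def apply_raise apply_wedge)
qed

lemma nil_algebra_degree_char_3_ge:
  assumes "(3::'k::field) = 0"
  shows "even d \<Longrightarrow> enat (3 * d + 1) \<le> nil_algebra_degree 3 d TYPE('k)"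
    and "odd d \<Longrightarrow> enat (3 * d) \<le> nil_algebra_degree 3 d TYPE('k)"
proof -
  interpret g: grassmann_letters "raise :: nat \<Rightarrow> 'k operator" wedge
    by (rule grassmann_letters_operator[OF assms])
  have deg: "enat (Suc (length w)) \<le> nil_algebra_degree 3 d TYPE('k)"
    if "apply_op (g.eval_word w) vacuum s \<noteq> 0" "set w \<subseteq> {..<d}" for w s
  proof -
    interpret cube_functional "\<lambda>w. apply_op (g.eval_word w) vacuum s"
      by (rule g.cube_functional_eval_word) simp
    show ?thesis by (rule nil_algebra_degree_gt_length) (use that in auto)
  qed
  show "enat (3 * d + 1) \<le> nil_algebra_degree 3 d TYPE('k)" if "even d"
  proof -
    from that obtain m where m: "d = 2 * m" by (elim evenE)
    show ?thesis
      using deg[OF block_word_top[OF assms, of m]] set_block_word[of m] by (simp add: m length_block_word)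
  qed
  show "enat (3 * d) \<le> nil_algebra_degree 3 d TYPE('k)" if "odd d"
  proof -
    from that obtain m where m: "d = 2 * m + 1" by (elim oddE)
    have "set ([2 * m, 2 * m] @ block_word m) \<subseteq> {..<d}" using set_block_word[of m] m by auto
    from deg[OF block_word_square_top[OF assms, of m] this]
    have "enat (Suc (length ([2 * m, 2 * m] @ block_word m))) \<le> nil_algebra_degree 3 d TYPE('k)" .
    moreover have "Suc (length ([2 * m, 2 * m] @ block_word m)) = 3 * d" by (simp add: m length_block_word)
    ultimately show ?thesis by (simp only:)
  qed
qed

section \<open>The nilpotency degree\<close>

lemma nil_algebra_degree_le_cubes:
  assumes "infinite (UNIV :: 'k::field set)"
  shows "nil_algebra_degree 3 d TYPE('k) \<le> enat (3 * d + 1)"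
proof (rule nil_algebra_degree_le)
  interpret null_words "null_word TYPE('k) d" by (rule null_words_null_word[OF assms])
  fix w assume w: "set w \<subseteq> {..<d}" "length w = 3 * d + 1"
  then have "null_word TYPE('k) d w" by (intro null_if_length_gt[of "{..<d}"]) auto
  then show "word w \<in> (nil_ideal 3 d :: (nat free_monoid \<Rightarrow>\<^sub>0 'k) set)"
    using w(1) by (simp add: null_word_def)
qed

lemma nil_algebra_degree_le_max:
  assumes "infinite (UNIV :: 'k::field set)" "(3::'k) \<noteq> 0"
  shows "nil_algebra_degree 3 d TYPE('k) \<le> enat (max 6 (d + 3))"
proof (rule nil_algebra_degree_le)
  interpret null_words_separated "null_word TYPE('k) d" by (rule null_words_separated_null_word[OF assms])
  fix w assume w: "set w \<subseteq> {..<d}" "length w = max 6 (d + 3)"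
  then have "null_word TYPE('k) d w" by (intro null_if_length_ge[of "{..<d}"]) auto
  then show "word w \<in> (nil_ideal 3 d :: (nat free_monoid \<Rightarrow>\<^sub>0 'k) set)"
    using w(1) by (simp add: null_word_def)
qed

lemma nil_algebra_degree_le_6:
  assumes "infinite (UNIV :: 'k::field set)" "(2::'k) \<noteq> 0" "(3::'k) \<noteq> 0"
  shows "nil_algebra_degree 3 d TYPE('k) \<le> 6"
  unfolding numeral_eq_enat
  by (rule nil_algebra_degree_le) (rule word_in_nil_ideal_6[OF assms])

theorem theorem1:
  fixes d :: nat and C :: enat
  assumes "infinite (UNIV :: 'k::field set)"
    and "d > 1"
    and "C = nil_algebra_degree 3 d TYPE('k)"
  shows "(CHAR('k) = 0 \<or> CHAR('k) > 3 \<longrightarrow> C = 6) \<and>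
         (CHAR('k) = 2 \<longrightarrow> (d \<ge> 3 \<longrightarrow> C = enat (d + 3)) \<and> (d = 2 \<longrightarrow> C = 6)) \<and>
         (CHAR('k) = 3 \<longrightarrow> (even d \<longrightarrow> C = enat (3 * d + 1)) \<and>
                          (odd d \<longrightarrow> C \<in> {enat (3 * d), enat (3 * d + 1)}))"
proof (intro conjI impI)
  note inf = assms(1) and C = assms(3)
  have numeral_zero: "(numeral n :: 'k) = 0 \<longleftrightarrow> CHAR('k) dvd numeral n" for n
    using of_nat_eq_0_iff_char_dvd[where ?'a = 'k, of "numeral n"] by simp
  have two: "(2::'k) = 0 \<longleftrightarrow> CHAR('k) dvd 2" and three: "(3::'k) = 0 \<longleftrightarrow> CHAR('k) dvd 3"
    by (rule numeral_zero)+
  show "C = 6" if "CHAR('k) = 0 \<or> CHAR('k) > 3"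
  proof -
    have "\<not> CHAR('k) dvd 2" "\<not> CHAR('k) dvd 3" using that by (auto dest: dvd_imp_le)
    then show ?thesis
      using nil_algebra_degree_le_6[OF inf, of d] nil_algebra_degree_ge_6[OF assms(2), where ?'k = 'k]
      unfolding C two three by (intro antisym)
  qed
  show "C = enat (d + 3)" if "CHAR('k) = 2" "d \<ge> 3"
  proof -
    have "nil_algebra_degree 3 d TYPE('k) \<le> enat (max 6 (d + 3))"
      by (rule nil_algebra_degree_le_max[OF inf]) (simp add: three that)
    moreover have "enat (d + 3) \<le> nil_algebra_degree 3 d TYPE('k)"
      by (rule nil_algebra_degree_char_2_ge) (use two that in auto)
    ultimately show ?thesis using that(2) unfolding C by (intro antisym) (simp_all add: max_def)
  qed
  show "C = 6" if "CHAR('k) = 2" "d = 2"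
  proof -
    have "nil_algebra_degree 3 d TYPE('k) \<le> enat (max 6 (d + 3))"
      by (rule nil_algebra_degree_le_max[OF inf]) (simp add: three that)
    then show ?thesis
      using nil_algebra_degree_ge_6[OF assms(2), where ?'k = 'k] that(2) unfolding C
      by (intro antisym) (simp_all add: numeral_eq_enat)
  qed
  have char_3: "(3::'k) = 0" if "CHAR('k) = 3" by (simp add: three that)
  show "C = enat (3 * d + 1)" if "CHAR('k) = 3" "even d"
    unfolding C
    by (intro antisym nil_algebra_degree_le_cubes inf nil_algebra_degree_char_3_ge(1) char_3 that)
  show "C \<in> {enat (3 * d), enat (3 * d + 1)}" if "CHAR('k) = 3" "odd d"
  proof -
    have "enat (3 * d) \<le> C" "C \<le> enat (3 * d + 1)"
      unfolding C by (intro nil_algebra_degree_le_cubes inf nil_algebra_degree_char_3_ge(2) char_3 that)+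
    then show ?thesis by (cases C) auto
  qed
qed

end
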